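(* Let $Y=(Y_t)_{t\ge0}$ be a one-dimensional Lévy process admitting all positive exponential moments, i.e. $\mathbb{E}[e^{uY_t}]<\infty$ for all $u,t\ge0$, and let $\Psi$, given by $$\Psi(u)=bu+\frac12\sigma^2u^2+\int_{-\infty}^\infty\left(e^{ur}-1-ur\,\mathbb{I}_{\{|r|\le1\}}\right)\Pi(dr),$$ be its characteristic exponent, so that $\mathbb{E}[e^{uY_t}]=e^{t\Psi(u)}$ for all $u,t\ge0$. (1) If $\sigma^2>0$, then the random variable $e^{Y_t}$ is moment indeterminate for any $t>0$. (2) If $\Psi(u)=u\log(u+1)$ for $u\ge0$, then the random variable $e^{Y_t}$ is moment determinate if and only if $t\le2$.
   Context: A Lévy process $Y=(Y_t)_{t\ge0}$ is an $\mathbb{R}$-valued stochastic process with stationary and independent increments, continuous in probability, with $Y_0=0$ almost surely. Here $b\in\mathbb{R}$, $\sigma\ge0$, and $\Pi$ is a $\sigma$-finite positive measure on $\mathbb{R}$ with $\Pi(\{0\})=0$ and $\int_{-\infty}^\infty\min(1,r^2)\,\Pi(dr)<\infty$; $\Psi$ is initially defined on $i\mathbb{R}$ (with $\mathbb{E}[e^{uY_t}]=e^{t\Psi(u)}$, $u\in i\mathbb{R}$), and the existence of all positive exponential moments is equivalent to $\int_1^\infty e^{ur}\Pi(dr)<\infty$ for all $u\ge0$, in which case $\Psi$ extends (by the same formula) to $\{\mathrm{Re}\,u\ge0\}$. A nonnegative random variable all of whose moments are finite is called moment determinate if its law is the only positive measure on $[0,\infty)$ having the same moments of all orders $n=0,1,2,\dots$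 (Stieltjes moment problem), and moment indeterminate otherwise. *)

theory Defs
  imports "HOL-Probability.Probability"
begin

(* The time set is the half-line [0, \<infinity>); values Y t with t < 0 are irrelevant. *)
locale levy_process = prob_space M for M :: "'a measure" +
  fixes Y :: "real \<Rightarrow> 'a \<Rightarrow> real"
  assumes random_variable: "0 \<le> t \<Longrightarrow> random_variable borel (Y t)"
    and start: "AE \<omega> in M. Y 0 \<omega> = 0"
    and indep_increments:
      "strict_mono_on {..n} \<tau> \<Longrightarrow> 0 \<le> \<tau> 0 \<Longrightarrow>
        indep_vars (\<lambda>_. borel) (\<lambda>i \<omega>. Y (\<tau> (Suc i)) \<omega> - Y (\<tau> i) \<omega>) {..<n::nat}"
    and stationary_increments:
      "0 \<le> s \<Longrightarrow> 0 \<le> h \<Longrightarrow>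
        distr M borel (\<lambda>\<omega>. Y (s + h) \<omega> - Y s \<omega>) = distr M borel (\<lambda>\<omega>. Y h \<omega> - Y 0 \<omega>)"
    and continuous_in_probability:
      "0 \<le> s \<Longrightarrow> 0 < \<epsilon> \<Longrightarrow>
        ((\<lambda>t. prob {\<omega> \<in> space M. \<epsilon> < \<bar>Y t \<omega> - Y s \<omega>\<bar>}) \<longlongrightarrow> 0) (at s within {0..})"

definition levy_measure :: "real measure \<Rightarrow> bool" where
  "levy_measure \<mu> \<longleftrightarrow>
     sets \<mu> = sets borel \<and> sigma_finite_measure \<mu> \<and> emeasure \<mu> {0} = 0 \<and>
     (\<integral>\<^sup>+ r. ennreal (min 1 (r\<^sup>2)) \<partial>\<mu>) < \<infinity>"

(* For a Levy measure the integrand is always integrable if Re u = 0; for Re u > 0 the value is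
   meaningful only if exp (Re u * r) is integrable over {1..}. *)
definition levy_exponent :: "real \<Rightarrow> real \<Rightarrow> real measure \<Rightarrow> complex \<Rightarrow> complex" where
  "levy_exponent b \<sigma> \<mu> u =
     of_real b * u + of_real (\<sigma>\<^sup>2) * u\<^sup>2 / 2 +
     (\<integral>r. (exp (u * of_real r) - 1 - u * of_real (r * indicator {-1..1} r)) \<partial>\<mu>)"

definition has_characteristic_exponent ::
    "'a measure \<Rightarrow> (real \<Rightarrow> 'a \<Rightarrow> real) \<Rightarrow> (complex \<Rightarrow> complex) \<Rightarrow> bool" where
  "has_characteristic_exponent M Y \<Psi> \<longleftrightarrow>
     (\<forall>u t. Re u = 0 \<longrightarrow> 0 \<le> t \<longrightarrow>
       (\<integral>\<omega>. exp (u * of_real (Y t \<omega>)) \<partial>M) = exp (of_real t * \<Psi> u))"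

definition nonneg_with_moments :: "'a measure \<Rightarrow> ('a \<Rightarrow> real) \<Rightarrow> bool" where
  "nonneg_with_moments M X \<longleftrightarrow>
     X \<in> borel_measurable M \<and> (AE \<omega> in M. 0 \<le> X \<omega>) \<and> (\<forall>n::nat. integrable M (\<lambda>\<omega>. X \<omega> ^ n))"

(* Measures on [0, \<infinity>) are represented as Borel measures on the real line that do not charge the
   negative half-line. *)
definition stieltjes_solution :: "(nat \<Rightarrow> real) \<Rightarrow> real measure \<Rightarrow> bool" where
  "stieltjes_solution m \<nu> \<longleftrightarrow>
     sets \<nu> = sets borel \<and> emeasure \<nu> {..<0} = 0 \<and>
     (\<forall>n. integrable \<nu> (\<lambda>x. x ^ n) \<and> (\<integral>x. x ^ n \<partial>\<nu>) = m n)"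

definition moment_determinate :: "'a measure \<Rightarrow> ('a \<Rightarrow> real) \<Rightarrow> bool" where
  "moment_determinate M X \<longleftrightarrow>
     nonneg_with_moments M X \<and>
     (\<forall>\<nu>. stieltjes_solution (\<lambda>n. \<integral>\<omega>. X \<omega> ^ n \<partial>M) \<nu> \<longrightarrow> \<nu> = distr M borel X)"

definition moment_indeterminate :: "'a measure \<Rightarrow> ('a \<Rightarrow> real) \<Rightarrow> bool" where
  "moment_indeterminate M X \<longleftrightarrow> nonneg_with_moments M X \<and> \<not> moment_determinate M X"

end

theory Submission
  imports Defs "HOL-Complex_Analysis.Complex_Analysis" "HOL-Real_Asymp.Real_Asymp"
begin

text \<open>
  If \<open>X = A Z\<close> with independent nonnegative factors and \<open>A\<close> has the same integer moments as some
  \<open>B\<close> but a different moment of fractional order, then \<open>A Z\<close> and \<open>B Z\<close> have the same integer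
  moments and different laws, so \<open>X\<close> is moment indeterminate. Only the moments of \<open>Z\<close> matter, and
  sequences realized by some \<open>Z\<close> are closed under products and pointwise limits.

  In part (1), \<open>A\<close> is log-normal and \<open>Z\<close> comes from the jumps and the drift. In part (2) the moments
  are \<open>(n + 1) powr (t * n)\<close>. For \<open>t > 2\<close> the factor \<open>A\<close> is the \<open>t\<close>-th power of a Gamma variable of
  shape \<open>t\<close>, with moments \<open>Gamma (t * (n + 1)) / Gamma t\<close>; that the quotient is a moment sequence
  follows from the iterated duplication formula, which writes its logarithm through exponents of Beta
  variables. For \<open>t \<le> 2\<close> the square root of \<open>X\<close> has an exponential moment, which makes its
  symmetrization, hence \<open>X\<close>, determinate.
\<close>

section \<open>Stieltjes moment sequences\<close>

text \<open>The law of \<open>exp (Y t)\<close> is known only through its transform, so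
  indeterminacy criteria that need a density do not apply to it directly; the factorization moves
  the question to a factor whose density is explicit and can be perturbed. A fractional moment,
  rather than the law, separates the two products because it is multiplicative: no cancellation of
  the common factor has to be proved. The bound 2 arises twice. The perturbation of the Gamma power
  oscillates with frequency \<open>tan (pi / t)\<close>, and the angle \<open>pi / t\<close> has to
  stay below \<open>pi / 2\<close>. On the other side, \<open>(n + 1) ^ (2 * n)\<close> exceeds
  \<open>fact (2 * n)\<close> by at most a geometric factor, which is the borderline for an
  exponential moment of the square root. The main obstacle is that the quotient by the Gamma moments
  must itself be a moment sequence. It is met by working with logarithms of moments, where the
  closure properties become those of a convex cone.\<close>

lemma pair_integral_mult:
  fixes f :: "'a \<Rightarrow> real" and g :: "'b \<Rightarrow> real"
  assumes "sigma_finite_measure M1" "sigma_finite_measure M2"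
    and f: "integrable M1 f" and g: "integrable M2 g"
  shows "integrable (M1 \<Otimes>\<^sub>M M2) (\<lambda>p. f (fst p) * g (snd p))"
    and "(\<integral>p. f (fst p) * g (snd p) \<partial>(M1 \<Otimes>\<^sub>M M2)) = (\<integral>x. f x \<partial>M1) * (\<integral>y. g y \<partial>M2)"
proof -
  interpret pair_sigma_finite M1 M2
    using assms by (simp add: pair_sigma_finite_def)
  have [measurable]: "f \<in> borel_measurable M1" "g \<in> borel_measurable M2" using f g by auto
  show *: "integrable (M1 \<Otimes>\<^sub>M M2) (\<lambda>p. f (fst p) * g (snd p))"
  proof (rule Fubini_integrable)
    show "integrable M1 (\<lambda>x. \<integral>y. norm (f (fst (x, y)) * g (snd (x, y))) \<partial>M2)"
      using f by (simp add: abs_mult)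
  qed (use g in auto)
  show "(\<integral>p. f (fst p) * g (snd p) \<partial>(M1 \<Otimes>\<^sub>M M2)) = (\<integral>x. f x \<partial>M1) * (\<integral>y. g y \<partial>M2)"
    by (subst integral_fst'[OF *, symmetric]) simp
qed

lemma AE_pair_fst_snd:
  assumes "sigma_finite_measure M2" and "AE x in M1. P x" and "AE y in M2. Q y"
  shows "AE p in M1 \<Otimes>\<^sub>M M2. P (fst p) \<and> Q (snd p)"
proof -
  interpret M2: sigma_finite_measure M2 by fact
  from assms(2) obtain N1 where N1: "N1 \<in> null_sets M1" "{x \<in> space M1. \<not> P x} \<subseteq> N1"
    by (auto elim!: AE_E intro: null_setsI)
  from assms(3) obtain N2 where N2: "N2 \<in> null_sets M2" "{y \<in> space M2. \<not> Q y} \<subseteq> N2"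
    by (auto elim!: AE_E intro: null_setsI)
  note [measurable] = null_setsD2[OF N1(1)] null_setsD2[OF N2(1)]
  have "N1 \<times> space M2 \<union> space M1 \<times> N2 \<in> null_sets (M1 \<Otimes>\<^sub>M M2)"
    using M2.emeasure_pair_measure_Times[of N1 M1 "space M2"]
      M2.emeasure_pair_measure_Times[of "space M1" M1 N2] N1(1) N2(1)
    by (intro null_sets.Un null_setsI) (auto simp: null_sets_def)
  then show ?thesis
    by (rule AE_I') (use N1 N2 in \<open>auto simp: space_pair_measure\<close>)
qed

lemma stieltjes_solution_distr:
  assumes [measurable]: "X \<in> borel_measurable N" and "AE \<omega> in N. 0 \<le> X \<omega>"
    and "\<And>n. integrable N (\<lambda>\<omega>. X \<omega> ^ n)" and "\<And>n. (\<integral>\<omega>. X \<omega> ^ n \<partial>N) = m n"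
  shows "stieltjes_solution m (distr N borel X)"
proof -
  have "emeasure (distr N borel X) {..<0} = emeasure N {\<omega> \<in> space N. X \<omega> < 0}"
    by (subst emeasure_distr) (auto intro!: arg_cong[where f="emeasure N"])
  also have "\<dots> = 0"
    using assms(2) by (intro emeasure_eq_0_AE) (auto simp: not_less)
  finally show ?thesis
    using assms(3,4) by (auto simp: stieltjes_solution_def integrable_distr_eq integral_distr)
qed

lemma stieltjes_solutionD:
  assumes "stieltjes_solution m \<nu>" and "m 0 = 1"
  shows "real_distribution \<nu>" "AE x in \<nu>. 0 \<le> x"
    "\<And>n. integrable \<nu> (\<lambda>x. x ^ n)" "\<And>n. (\<integral>x. x ^ n \<partial>\<nu>) = m n"
proof -
  have S: "sets \<nu> = sets borel" and E: "emeasure \<nu> {..<0} = 0"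
    and I: "\<And>n. integrable \<nu> (\<lambda>x. x ^ n)" and M: "\<And>n. (\<integral>x. x ^ n \<partial>\<nu>) = m n"
    using assms(1) by (auto simp: stieltjes_solution_def)
  show "\<And>n. integrable \<nu> (\<lambda>x. x ^ n)" "\<And>n. (\<integral>x. x ^ n \<partial>\<nu>) = m n" by fact+
  have "{..<0} \<in> null_sets \<nu>" using E S by (simp add: null_sets_def)
  then show "AE x in \<nu>. 0 \<le> x"
    by (rule AE_I') auto
  have "integrable \<nu> (\<lambda>x. 1::real)" "(\<integral>x. 1 \<partial>\<nu>) = (1::real)"
    using I[of 0] M[of 0] assms(2) by simp_all
  then have "(\<integral>\<^sup>+x. 1 \<partial>\<nu>) = 1"
    using nn_integral_eq_integral[of \<nu> "\<lambda>_. 1"] by simp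
  then have "prob_space \<nu>" by (intro prob_spaceI) simp
  with S show "real_distribution \<nu>"
    by (simp add: real_distribution_def real_distribution_axioms_def sets_eq_imp_space_eq[OF S])
qed

text \<open>The normalization makes every solution a probability measure, hence a possible law of an
  independent factor. Which solution is taken never matters, so only the sequence is
  recorded.\<close>

definition moment_seq :: "(nat \<Rightarrow> real) \<Rightarrow> bool" where
  "moment_seq m \<longleftrightarrow> m 0 = 1 \<and> (\<exists>\<nu>. stieltjes_solution m \<nu>)"

lemma moment_seqE:
  assumes "moment_seq m"
  obtains \<nu> where "stieltjes_solution m \<nu>" "real_distribution \<nu>" "AE x in \<nu>. 0 \<le> x"
    "\<And>n. integrable \<nu> (\<lambda>x. x ^ n)" "\<And>n. (\<integral>x. x ^ n \<partial>\<nu>) = m n"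
proof -
  from assms obtain \<nu> where "stieltjes_solution m \<nu>" "m 0 = 1"
    by (auto simp: moment_seq_def)
  then show ?thesis
    using stieltjes_solutionD by (intro that) 
qed

lemma moment_seqI:
  assumes "prob_space N" "X \<in> borel_measurable N" "AE \<omega> in N. 0 \<le> X \<omega>"
    and "\<And>n. integrable N (\<lambda>\<omega>. X \<omega> ^ n)" "\<And>n. (\<integral>\<omega>. X \<omega> ^ n \<partial>N) = m n"
  shows "moment_seq m"
proof -
  interpret prob_space N by fact
  have "m 0 = 1" using assms(5)[of 0] by (simp add: prob_space)
  then show ?thesis
    unfolding moment_seq_def using stieltjes_solution_distr[OF assms(2-5)] by blast
qed

lemma moment_seq_power:
  assumes "0 \<le> c"
  shows "moment_seq (\<lambda>n. c ^ n)"
proof -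
  interpret prob_space "return borel (0::real)" by (simp add: prob_space_return)
  show ?thesis
    by (rule moment_seqI[of "return borel 0" "\<lambda>_. c"])
      (use assms prob_space_axioms prob_space in auto)
qed

lemma stieltjes_solution_mult:
  assumes "stieltjes_solution m \<nu>" "m 0 = 1" "stieltjes_solution m' \<nu>'" "m' 0 = 1"
  shows "stieltjes_solution (\<lambda>n. m n * m' n) (distr (\<nu> \<Otimes>\<^sub>M \<nu>') borel (\<lambda>p. fst p * snd p))"
proof -
  note \<nu> = stieltjes_solutionD[OF assms(1,2)] and \<nu>' = stieltjes_solutionD[OF assms(3,4)]
  interpret \<nu>: real_distribution \<nu> by fact
  interpret \<nu>': real_distribution \<nu>' by fact
  note pm = pair_integral_mult[OF \<nu>.sigma_finite_measure_axioms \<nu>'.sigma_finite_measure_axioms]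
  show ?thesis
  proof (rule stieltjes_solution_distr)
    show "AE p in \<nu> \<Otimes>\<^sub>M \<nu>'. 0 \<le> fst p * snd p"
      using AE_pair_fst_snd[OF \<nu>'.sigma_finite_measure_axioms \<nu>(2) \<nu>'(2)] by eventually_elim simp
  qed (use pm[OF \<nu>(3) \<nu>'(3)] \<nu>(4) \<nu>'(4) in \<open>auto simp: power_mult_distrib\<close>)
qed

lemma moment_seq_mult:
  "moment_seq m \<Longrightarrow> moment_seq m' \<Longrightarrow> moment_seq (\<lambda>n. m n * m' n)"
  unfolding moment_seq_def using stieltjes_solution_mult by (metis mult_1)

lemma moment_seq_power_mult: "moment_seq m \<Longrightarrow> moment_seq (\<lambda>n. m n ^ k)"
  by (induction k) (use moment_seq_power[of 1] moment_seq_mult in auto)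

text \<open>A factor that is 1, hence without effect, with probability \<open>1 - p\<close> and
  follows the given law otherwise. In multiplicative form this is a single possible jump, from which
  compound Poisson laws are built.\<close>

lemma moment_seq_mixture_1:
  assumes "moment_seq m" "0 \<le> p" "p \<le> 1"
  shows "moment_seq (\<lambda>n. (1 - p) + p * m n)"
proof -
  obtain \<nu> where \<nu>: "real_distribution \<nu>" "AE x in \<nu>. 0 \<le> x"
    "\<And>n. integrable \<nu> (\<lambda>x. x ^ n)" "\<And>n. (\<integral>x. x ^ n \<partial>\<nu>) = m n"
    using moment_seqE[OF assms(1)] by metis
  interpret \<nu>: real_distribution \<nu> by fact
  let ?B = "measure_pmf (bernoulli_pmf p)"
  interpret pair_prob_space ?B \<nu> ..
  note pm = pair_integral_mult[OF measure_pmf.sigma_finite_measure_axioms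
      \<nu>.sigma_finite_measure_axioms integrable_measure_pmf_finite]
  have *: "(if b then x else 1) ^ n = of_bool b * x ^ n + of_bool (\<not> b) * 1" for b and x :: real and n
    by simp
  show ?thesis
  proof (rule moment_seqI[of "?B \<Otimes>\<^sub>M \<nu>" "\<lambda>q. if fst q then snd q else 1"])
    have "AE b in ?B. True" by simp
    from AE_pair_fst_snd[OF \<nu>.sigma_finite_measure_axioms this \<nu>(2)]
    show "AE q in ?B \<Otimes>\<^sub>M \<nu>. 0 \<le> (if fst q then snd q else 1)"
      by eventually_elim simp
    have 1: "integrable (?B \<Otimes>\<^sub>M \<nu>) (\<lambda>q. of_bool (fst q) * snd q ^ n)"
      "(\<integral>q. of_bool (fst q) * snd q ^ n \<partial>(?B \<Otimes>\<^sub>M \<nu>)) = p * m n" for n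
      using pm[where f = "of_bool :: bool \<Rightarrow> real", OF _ \<nu>(3)] assms by (auto simp: \<nu>(4))
    have 2: "integrable (?B \<Otimes>\<^sub>M \<nu>) (\<lambda>q. of_bool (\<not> fst q) * 1 :: real)"
      "(\<integral>q. of_bool (\<not> fst q) * 1 \<partial>(?B \<Otimes>\<^sub>M \<nu>)) = 1 - p"
      using pm[where f = "\<lambda>b. of_bool (\<not> b) :: real" and g = "\<lambda>_. 1"] assms \<nu>.prob_space by auto
    show "integrable (?B \<Otimes>\<^sub>M \<nu>) (\<lambda>q. (if fst q then snd q else 1) ^ n)" for n
      unfolding * using 1(1) 2(1) by (rule Bochner_Integration.integrable_add)
    show "(\<integral>q. (if fst q then snd q else 1) ^ n \<partial>(?B \<Otimes>\<^sub>M \<nu>)) = (1 - p) + p * m n" for n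
      unfolding * using 1 2 by (subst Bochner_Integration.integral_add) auto
  qed (auto simp: prob_space_axioms)
qed

section \<open>Weak limits of moment sequences\<close>

lemma moment_seq_tight:
  assumes \<nu>: "\<And>k. real_distribution (\<nu> k)" and nonneg: "\<And>k. AE x in \<nu> k. 0 \<le> x"
    and int: "\<And>k. integrable (\<nu> k) (\<lambda>x. x)" and le: "\<And>k. (\<integral>x. x \<partial>\<nu> k) \<le> C"
  shows "tight \<nu>"
  unfolding tight_def
proof (intro conjI allI impI \<nu>)
  fix \<epsilon> :: real assume "0 < \<epsilon>"
  define K where "K = (\<bar>C\<bar> + 1) / \<epsilon>"
  have K: "0 < K" using \<open>0 < \<epsilon>\<close> by (simp add: K_def add_nonneg_pos)
  \<comment> \<open>Tightness is stated with intervals open on the left; starting at -1 keeps a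
    possible atom at 0 inside.\<close>
  have "1 - \<epsilon> < measure (\<nu> k) {-1<..K}" for k
  proof -
    interpret real_distribution "\<nu> k" by (rule \<nu>)
    have "measure (\<nu> k) {x \<in> space (\<nu> k). K \<le> x} \<le> (\<integral>x. x \<partial>\<nu> k) / K"
      using int nonneg K by (intro integral_Markov_inequality_measure[of _ _ "{}"]) auto
    also have "\<dots> \<le> C / K" using le K by (intro divide_right_mono) auto
    also have "\<dots> < \<epsilon>" using K \<open>0 < \<epsilon>\<close> abs_ge_self[of C]
      by (simp add: K_def divide_less_eq mult.commute[of \<epsilon>] flip: times_divide_eq_left)
    finally have 1: "measure (\<nu> k) {K..} < \<epsilon>" by (simp add: atLeast_def)
    have "1 = prob {x \<in> space (\<nu> k). 0 \<le> x}"
      using nonneg[of k] by (subst prob_Collect_eq_1[THEN iffD2]) auto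
    also have "\<dots> \<le> prob ({-1<..K} \<union> {K..})" by (intro finite_measure_mono) auto
    also have "\<dots> \<le> prob {-1<..K} + prob {K..}" by (intro measure_Un_le) auto
    finally show ?thesis using 1 by simp
  qed
  then show "\<exists>a b. a < b \<and> (\<forall>n. 1 - \<epsilon> < measure (\<nu> n) {a<..b})"
    using K by (intro exI[of _ "-1"] exI[of _ K]) auto
qed

text \<open>Bounded moments of order one give tightness, and boundedness of the moments of order
  \<open>n + 1\<close> makes the moments of order \<open>n\<close> pass to the weak limit.\<close>

lemma moment_seq_limit:
  assumes seq: "\<And>k. moment_seq (m k)" and lim: "\<And>n. (\<lambda>k. m k n) \<longlonglongrightarrow> m' n"
  shows "moment_seq m'"
proof -
  have "\<exists>\<nu>. real_distribution \<nu> \<and> (AE x in \<nu>. 0 \<le> x) \<and> (\<forall>n. integrable \<nu> (\<lambda>x. x ^ n)) \<and>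
      (\<forall>n. (\<integral>x. x ^ n \<partial>\<nu>) = m k n)" for k
    using moment_seqE[OF seq[of k]] by metis
  then obtain \<nu> where \<nu>: "\<And>k. real_distribution (\<nu> k)" "\<And>k. AE x in \<nu> k. 0 \<le> x"
    "\<And>k n. integrable (\<nu> k) (\<lambda>x. x ^ n)" "\<And>k n. (\<integral>x. x ^ n \<partial>\<nu> k) = m k n"
    by metis
  obtain C where C: "\<And>k. m k 1 \<le> C"
    using convergent_imp_Bseq[OF convergentI[OF lim[of 1]]]
    by (elim BseqE) (auto simp: abs_le_iff)
  have "tight \<nu>"
    using moment_seq_tight[of \<nu> C] \<nu>(1,2) \<nu>(3)[of _ 1] \<nu>(4)[of _ 1] C by simp
  from tight_imp_convergent_subsubsequence[OF this strict_mono_id]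
  obtain r N where r: "strict_mono r" and "real_distribution N" and wc: "weak_conv_m (\<nu> \<circ> r) N"
    by auto
  interpret N: real_distribution N by fact
  have conv: "(\<lambda>k. \<integral>x. f x \<partial>\<nu> (r k)) \<longlonglongrightarrow> (\<integral>x. f x \<partial>N)"
    if "\<And>x. isCont f x" "\<And>x. \<bar>f x\<bar> \<le> B" for f :: "real \<Rightarrow> real" and B
    using weak_conv_imp_integral_bdd_continuous_conv[of "\<nu> \<circ> r" N f B] \<nu>(1) N.real_distribution_axioms wc that
    by (simp add: o_def)
  have limr: "(\<lambda>k. m (r k) n) \<longlonglongrightarrow> m' n" for n
    using LIMSEQ_subseq_LIMSEQ[OF lim r] by (simp add: o_def)
  have N0: "AE x in N. 0 \<le> x"
  proof -
    \<comment> \<open>A bounded continuous test function that vanishes exactly on the closed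
      half-line, so that its integral detects mass on the negative side of the limit.\<close>
    define f where "f = (\<lambda>x::real. min (max (-x) 0) 1)"
    have [measurable]: "f \<in> borel_measurable borel" unfolding f_def by measurable
    have f: "isCont f x" "\<bar>f x\<bar> \<le> 1" "0 \<le> f x" for x
      unfolding f_def by (intro continuous_intros) auto
    have "(\<integral>x. f x \<partial>\<nu> (r k)) = 0" for k
    proof -
      interpret real_distribution "\<nu> (r k)" by (rule \<nu>)
      have "(\<integral>x. f x \<partial>\<nu> (r k)) = (\<integral>x. 0 \<partial>\<nu> (r k))"
      proof (rule integral_cong_AE)
        show "AE x in \<nu> (r k). f x = 0" using \<nu>(2)[of "r k"] by eventually_elim (simp add: f_def)
      qed auto
      then show ?thesis by simp
    qed
    with conv[OF f(1,2)] have "(\<integral>x. f x \<partial>N) = 0" by (simp add: LIMSEQ_const_iff)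
    moreover have "integrable N f"
      by (rule N.integrable_const_bound[of _ 1]) (use f in auto)
    ultimately have "AE x in N. f x = 0"
      using integral_nonneg_eq_0_iff_AE[of N f] f by simp
    then show ?thesis by eventually_elim (auto simp: f_def min_def max_def split: if_splits)
  qed
  \<comment> \<open>Weak convergence handles only bounded functions, so powers are cut off at height
    \<open>K\<close>. What is cut off lies above \<open>K\<close>, where \<open>x ^ n\<close> is at
    most \<open>x ^ Suc n / K\<close>.\<close>
  define g where "g = (\<lambda>(K::nat) n (x::real). min (max x 0) (real K) ^ n)"
  have [measurable]: "g K n \<in> borel_measurable borel" for K n unfolding g_def by measurable
  have g: "isCont (g K n) x" "0 \<le> g K n x" "\<bar>g K n x\<bar> \<le> real K ^ n" for K n x
    unfolding g_def by (intro continuous_intros) (auto intro!: power_mono)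
  have g_int: "integrable (\<nu> k) (g K n)" for k K n
  proof -
    interpret real_distribution "\<nu> k" by (rule \<nu>)
    show ?thesis by (rule integrable_const_bound[of _ "real K ^ n"]) (use g in auto)
  qed
  have g_int_N: "integrable N (g K n)" for K n
    by (rule N.integrable_const_bound[of _ "real K ^ n"]) (use g in auto)
  have g_le: "g K n x \<le> x ^ n" if "0 \<le> x" for K n x
    using that by (auto simp: g_def intro!: power_mono)
  have g_ge: "x ^ n \<le> g K n x + x ^ Suc n / K" if "0 \<le> x" "K > 0" for K n x
  proof (cases "x \<le> K")
    case False
    then have "x ^ n * K \<le> x ^ n * x" using that by (intro mult_left_mono) auto
    then have "x ^ n \<le> x ^ Suc n / K" using that by (simp add: field_simps)
    then show ?thesis using g(2)[of K n x] by linarith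
  qed (use that in \<open>simp add: g_def\<close>)
  have up: "(\<integral>x. g K n x \<partial>N) \<le> m' n" for K n
  proof (rule LIMSEQ_le[OF conv[OF g(1,3)] limr])
    have "(\<integral>x. g K n x \<partial>\<nu> k) \<le> (\<integral>x. x ^ n \<partial>\<nu> k)" for k
      using \<nu>(2)[of k] by (intro integral_mono_AE g_int \<nu>(3)) (auto intro: g_le)
    then show "\<exists>M. \<forall>k\<ge>M. (\<integral>x. g K n x \<partial>\<nu> (r k)) \<le> m (r k) n" by (simp add: \<nu>(4))
  qed
  have low: "m' n \<le> (\<integral>x. g K n x \<partial>N) + m' (Suc n) / K" if "K > 0" for K n
  proof (rule LIMSEQ_le[OF limr])
    show "(\<lambda>k. (\<integral>x. g K n x \<partial>\<nu> (r k)) + m (r k) (Suc n) / K)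
        \<longlonglongrightarrow> (\<integral>x. g K n x \<partial>N) + m' (Suc n) / K"
      by (intro tendsto_intros conv[OF g(1,3)] limr) (use that in auto)
    have "(\<integral>x. x ^ n \<partial>\<nu> k) \<le> (\<integral>x. g K n x + x ^ Suc n / K \<partial>\<nu> k)" for k
      using \<nu>(2)[of k] that
      by (intro integral_mono_AE Bochner_Integration.integrable_add g_int \<nu>(3) integrable_divide)
        (auto intro: g_ge simp del: power_Suc)
    also have "(\<integral>x. g K n x + x ^ Suc n / K \<partial>\<nu> k) = (\<integral>x. g K n x \<partial>\<nu> k) + m k (Suc n) / K" for k
      by (subst Bochner_Integration.integral_add)
        (use \<nu>(3)[of k "Suc n"] \<nu>(4)[of k "Suc n"] g_int in auto)
    finally show "\<exists>M. \<forall>k\<ge>M. m (r k) n \<le> (\<integral>x. g K n x \<partial>\<nu> (r k)) + m (r k) (Suc n) / K"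
      by (simp add: \<nu>(4))
  qed
  have glim: "(\<lambda>K. \<integral>x. g K n x \<partial>N) \<longlonglongrightarrow> m' n" for n
  proof (rule tendsto_sandwich[OF _ _ _ tendsto_const])
    show "eventually (\<lambda>K. m' n - m' (Suc n) / K \<le> (\<integral>x. g K n x \<partial>N)) sequentially"
      by (rule eventually_sequentiallyI[of 1]) (use low[of _ n] in \<open>simp add: algebra_simps\<close>)
    have "(\<lambda>K. m' n - m' (Suc n) / real K) \<longlonglongrightarrow> m' n - 0"
      by (intro tendsto_diff tendsto_const lim_const_over_n)
    then show "(\<lambda>K. m' n - m' (Suc n) / real K) \<longlonglongrightarrow> m' n" by simp
  qed (simp add: up)
  have "integrable N (\<lambda>x. x ^ n)" "(\<integral>x. x ^ n \<partial>N) = m' n" for n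
  proof -
    have 1: "AE x in N. mono (\<lambda>K. g K n x)"
      by (auto simp: mono_def g_def intro!: power_mono)
    have 2: "AE x in N. (\<lambda>K. g K n x) \<longlonglongrightarrow> x ^ n"
      using N0
    proof eventually_elim
      case (elim x)
      obtain K0 :: nat where "x \<le> K0" using real_arch_simple by blast
      then have "eventually (\<lambda>K. g K n x = x ^ n) sequentially"
        using elim by (intro eventually_sequentiallyI[of K0]) (auto simp: g_def min_def)
      then show ?case by (rule tendsto_eventually)
    qed
    note integral_monotone_convergence_nonneg[OF g_int_N 1 _ 2 glim]
    then show "integrable N (\<lambda>x. x ^ n)" "(\<integral>x. x ^ n \<partial>N) = m' n" using g(2) by auto
  qed
  then show ?thesis
    by (intro moment_seqI[of N "\<lambda>x. x"] N0 N.prob_space_axioms)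
      auto
qed

section \<open>Infinitely divisible moment sequences\<close>

text \<open>The multiplicative compound Poisson law with rate \<open>c\<close>: it is the limit of
  \<open>N\<close> independent factors, each different from 1 with probability \<open>c / N\<close>,
  by the limit \<open>(1 + x / N) ^ N\<close> for the exponential.\<close>

lemma moment_seq_exp_minus_1:
  assumes "moment_seq m" "0 \<le> c"
  shows "moment_seq (\<lambda>n. exp (c * (m n - 1)))"
proof -
  \<comment> \<open>Shifting the number of factors by \<open>K\<close> keeps the mixing weight in
    the unit interval from the start.\<close>
  obtain K :: nat where K: "c \<le> K" using real_arch_simple by blast
  show ?thesis
  proof (rule moment_seq_limit)
    fix k
    have "moment_seq (\<lambda>n. (1 - c / (k + Suc K)) + c / (k + Suc K) * m n)"
      using assms K by (intro moment_seq_mixture_1) auto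
    then show "moment_seq (\<lambda>n. ((1 - c / (k + Suc K)) + c / (k + Suc K) * m n) ^ (k + Suc K))"
      by (rule moment_seq_power_mult)
  next
    fix n
    have "(\<lambda>k. (1 + c * (m n - 1) / real (k + Suc K)) ^ (k + Suc K)) \<longlonglongrightarrow> exp (c * (m n - 1))"
      by (rule LIMSEQ_ignore_initial_segment[OF tendsto_exp_limit_sequentially])
    then show "(\<lambda>k. ((1 - c / (k + Suc K)) + c / (k + Suc K) * m n) ^ (k + Suc K))
        \<longlonglongrightarrow> exp (c * (m n - 1))"
      by (simp add: algebra_simps diff_divide_distrib)
  qed
qed

text \<open>Asking for all multiples \<open>c\<close> encodes infinite divisibility with respect to
  products of independent factors. The resulting functions form a convex cone closed under pointwise
  limits, so exponents can be assembled as series with nonnegative weights.\<close>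

definition infdiv_exponent :: "(nat \<Rightarrow> real) \<Rightarrow> bool" where
  "infdiv_exponent g \<longleftrightarrow> (\<forall>c\<ge>0. moment_seq (\<lambda>n. exp (c * g n)))"

lemma infdiv_exponentD: "infdiv_exponent g \<Longrightarrow> moment_seq (\<lambda>n. exp (g n))"
  unfolding infdiv_exponent_def by (drule spec[of _ 1]) simp

lemma infdiv_exponent_add:
  assumes "infdiv_exponent g" "infdiv_exponent h"
  shows "infdiv_exponent (\<lambda>n. g n + h n)"
  using assms by (simp add: infdiv_exponent_def distrib_left exp_add moment_seq_mult)

lemma infdiv_exponent_scale:
  "infdiv_exponent g \<Longrightarrow> 0 \<le> a \<Longrightarrow> infdiv_exponent (\<lambda>n. a * g n)"
  by (simp add: infdiv_exponent_def mult.assoc[symmetric])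

text \<open>A constant factor \<open>exp a\<close>; both signs of \<open>a\<close> are allowed, so
  linear terms can always be added or removed.\<close>

lemma infdiv_exponent_linear: "infdiv_exponent (\<lambda>n. a * real n)"
proof -
  have "exp (c * (a * real n)) = exp (c * a) ^ n" for c n
    by (simp add: exp_of_nat_mult[symmetric] mult_ac)
  then show ?thesis by (simp add: infdiv_exponent_def moment_seq_power)
qed

lemma infdiv_exponent_minus_1: "moment_seq m \<Longrightarrow> infdiv_exponent (\<lambda>n. m n - 1)"
  by (simp add: infdiv_exponent_def moment_seq_exp_minus_1)

lemma infdiv_exponent_limit:
  assumes "\<And>k. infdiv_exponent (g k)" "\<And>n. (\<lambda>k. g k n) \<longlonglongrightarrow> g' n"
  shows "infdiv_exponent g'"
  unfolding infdiv_exponent_def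
proof (intro allI impI)
  fix c :: real assume c: "0 \<le> c"
  show "moment_seq (\<lambda>n. exp (c * g' n))"
  proof (rule moment_seq_limit)
    show "moment_seq (\<lambda>n. exp (c * g k n))" for k
      using assms(1) c by (simp add: infdiv_exponent_def)
    show "(\<lambda>k. exp (c * g k n)) \<longlonglongrightarrow> exp (c * g' n)" for n
      by (intro tendsto_exp tendsto_mult_left assms(2))
  qed
qed

lemma infdiv_exponent_sum:
  assumes "\<And>i. i \<in> I \<Longrightarrow> infdiv_exponent (g i)"
  shows "infdiv_exponent (\<lambda>n. \<Sum>i\<in>I. g i n)"
  using assms
proof (induction I rule: infinite_finite_induct)
  case (insert i I)
  then show ?case by (simp add: infdiv_exponent_add)
qed (use infdiv_exponent_linear[of 0] in simp_all)

text \<open>The total mass \<open>l\<close> is the rate, and the normalized measure, carried over by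
  \<open>exp\<close>, is the law of one factor. The zero measure cannot be normalized and gives the
  exponent 0.\<close>

lemma infdiv_exponent_compound_poisson:
  assumes "finite_measure \<mu>" "sets \<mu> = sets borel"
    and int: "\<And>n::nat. integrable \<mu> (\<lambda>r. exp (real n * r))"
  shows "infdiv_exponent (\<lambda>n. \<integral>r. exp (real n * r) - 1 \<partial>\<mu>)"
proof -
  interpret finite_measure \<mu> by fact
  note [measurable_cong] = assms(2)
  define l where "l = measure \<mu> UNIV"
  have space: "space \<mu> = UNIV" using sets_eq_imp_space_eq[OF assms(2)] by simp
  have 1: "(\<integral>r. exp (real n * r) - 1 \<partial>\<mu>) = (\<integral>r. exp (real n * r) \<partial>\<mu>) - l" for n
    using int by (simp add: l_def space)
  show ?thesis
  proof (cases "l = 0")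
    case True
    then have "AE r in \<mu>. False"
      by (intro AE_I[of _ _ UNIV]) (auto simp: space emeasure_eq_measure l_def assms(2))
    then have "AE r in \<mu>. exp (real n * r) - 1 = 0" for n
      by (rule AE_mp) simp
    then have "(\<integral>r. exp (real n * r) - 1 \<partial>\<mu>) = 0" for n
      by (rule integral_eq_zero_AE)
    then show ?thesis using infdiv_exponent_linear[of 0] by simp
  next
    case False
    then have l: "l > 0" by (simp add: l_def less_le)
    define N where "N = scale_measure (ennreal (1 / l)) \<mu>"
    have sN [measurable_cong]: "sets N = sets borel" by (simp add: N_def assms(2))
    have "prob_space N"
      using l by (intro prob_spaceI)
        (auto simp: N_def space_scale_measure space emeasure_eq_measure l_def ennreal_mult'[symmetric])
    have N: "integrable N f \<and> (\<integral>r. f r \<partial>N) = (\<integral>r. f r \<partial>\<mu>) / l" if "integrable \<mu> f" for f :: "real \<Rightarrow> real"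
    proof -
      have "N = density \<mu> (\<lambda>_. ennreal (1 / l))" 
        by (rule measure_eqI) (auto simp: N_def emeasure_density nn_integral_cmult_indicator)
      then show ?thesis
        using that l by (auto simp: integrable_density integral_density)
    qed
    have "moment_seq (\<lambda>n. (\<integral>r. exp (real n * r) \<partial>\<mu>) / l)"
      by (rule moment_seqI[OF \<open>prob_space N\<close>, of exp])
        (use N[OF int] in \<open>auto simp: exp_of_nat_mult[symmetric]\<close>)
    from infdiv_exponent_scale[OF infdiv_exponent_minus_1[OF this], of l]
    moreover have "l * ((\<integral>r. exp (real n * r) \<partial>\<mu>) / l - 1) = (\<integral>r. exp (real n * r) - 1 \<partial>\<mu>)" for n
      unfolding 1 using l by (simp add: right_diff_distrib)
    ultimately show ?thesis using l by simp
  qed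
qed

section \<open>Beta moments and logarithms of ratios\<close>

text \<open>These are the moments of \<open>exp (- T)\<close> with \<open>T\<close> exponential of
  rate \<open>a\<close>, that is, of the Beta law with parameters \<open>a\<close> and 1. Tilting
  the density by \<open>exp (- n * x)\<close> changes the rate to \<open>n + a\<close>.\<close>

lemma moment_seq_reciprocal:
  assumes "0 < a"
  shows "moment_seq (\<lambda>n. a / (real n + a))"
proof (rule moment_seqI[where X = "\<lambda>x. exp (- x)"])
  show "prob_space (density lborel (exponential_density a))"
    by (rule prob_space_exponential_density) fact
  have eq: "exponential_density a x * exp (- x) ^ n = a / (real n + a) * exponential_density (real n + a) x"
    for x n
  proof -
    have "exp (- x * a) * exp (- x) ^ n = exp (- x * (real n + a))"
      by (simp add: exp_of_nat_mult[symmetric] exp_add[symmetric] algebra_simps)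
    then show ?thesis using assms by (simp add: exponential_density_def mult.assoc)
  qed
  have *: "has_bochner_integral lborel (exponential_density (real n + a)) 1" for n
  proof (rule has_bochner_integral_nn_integral)
    have "0 < real n + a" using assms by simp
    from prob_space.emeasure_space_1[OF prob_space_exponential_density[OF this]]
    show "(\<integral>\<^sup>+x. ennreal (exponential_density (real n + a) x) \<partial>lborel) = ennreal 1"
      by (simp add: emeasure_density)
  qed (use assms in \<open>auto simp: exponential_density_nonneg\<close>)
  show "integrable (density lborel (exponential_density a)) (\<lambda>x. exp (- x) ^ n)" for n
    using assms * by (subst integrable_density)
      (auto simp: exponential_density_nonneg eq has_bochner_integral_iff)
  show "(\<integral>x. exp (- x) ^ n \<partial>density lborel (exponential_density a)) = a / (real n + a)" for n
    using assms * by (subst integral_density)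
      (auto simp: exponential_density_nonneg eq has_bochner_integral_iff)
qed simp_all

text \<open>The logarithmic series of \<open>1 - (1 - a / b) * (b / (n + b)) = (n + a) / (n + b)\<close> has
  coefficients of the right sign.\<close>

lemma infdiv_exponent_ln_ratio:
  assumes "0 < a" "a \<le> b"
  shows "infdiv_exponent (\<lambda>n. ln ((real n + b) / (real n + a)) - ln (b / a))"
proof (rule infdiv_exponent_limit)
  define q where "q = 1 - a / b"
  have q: "0 \<le> q" "q < 1" using assms by (auto simp: q_def)
  \<comment> \<open>The term for \<open>k = 0\<close> is 0, as division by zero yields 0, so these
    are partial sums of the logarithmic series, which starts at 1.\<close>
  show "infdiv_exponent (\<lambda>n. \<Sum>k<N. q ^ k / real k * ((b / (real n + b)) ^ k - 1))" for N
    by (intro infdiv_exponent_sum infdiv_exponent_scale infdiv_exponent_minus_1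
        moment_seq_power_mult moment_seq_reciprocal) (use assms q in auto)
  fix n
  have ser: "(\<lambda>k. y ^ k / real k) sums - ln (1 - y)" if "0 \<le> y" "y < 1" for y
    using sums_minus[OF ln_series'[of "- y"]] that by simp
  define y where "y = q * (b / (real n + b))"
  have "q * b = b - a" using assms by (simp add: q_def field_simps)
  then have "y = (b - a) / (real n + b)" by (simp add: y_def)
  then have y: "1 - y = (real n + a) / (real n + b)" using assms by (simp add: field_simps)
  have "0 < 1 - y" unfolding y using assms by simp
  moreover have "0 \<le> y" using assms q by (simp add: y_def)
  ultimately have "0 \<le> y" "y < 1" by simp_all
  from sums_diff[OF ser[OF this] ser[OF q]]
  have "(\<lambda>k. y ^ k / real k - q ^ k / real k) sums (- ln (1 - y) - - ln (1 - q))" .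
  moreover have "- ln (1 - y) - - ln (1 - q) = ln ((real n + b) / (real n + a)) - ln (b / a)"
    unfolding y using assms by (simp add: q_def ln_div)
  moreover have "y ^ k / real k - q ^ k / real k = q ^ k / real k * ((b / (real n + b)) ^ k - 1)" for k
    unfolding y_def power_mult_distrib by (simp add: right_diff_distrib)
  ultimately show "(\<lambda>N. \<Sum>k<N. q ^ k / real k * ((b / (real n + b)) ^ k - 1))
      \<longlonglongrightarrow> ln ((real n + b) / (real n + a)) - ln (b / a)"
    by (simp add: sums_def)
qed

text \<open>Let \<open>b\<close> tend to infinity in \<open>infdiv_exponent_ln_ratio\<close>: then
  \<open>ln ((n + b) / b)\<close> disappears.\<close>

lemma infdiv_exponent_minus_ln:
  assumes "0 < a"
  shows "infdiv_exponent (\<lambda>n. ln a - ln (real n + a))"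
proof (rule infdiv_exponent_limit)
  show "infdiv_exponent (\<lambda>n. ln ((real n + (a + real k)) / (real n + a)) - ln ((a + real k) / a))" for k
    by (rule infdiv_exponent_ln_ratio) (use assms in auto)
  fix n
  have "(\<lambda>k. ln ((real n + (a + real k)) / (real n + a)) - ln ((a + real k) / a))
      \<longlonglongrightarrow> ln a - ln (real n + a)"
    using assms by (real_asymp simp: ln_inverse)
  then show "(\<lambda>k. ln ((real n + (a + real k)) / (real n + a)) - ln ((a + real k) / a))
      \<longlonglongrightarrow> ln a - ln (real n + a)" .
qed

section \<open>The exponent of the power moments relative to the Gamma function\<close>

lemma ln_Gamma_plus1: "0 < x \<Longrightarrow> ln_Gamma (x + 1) = ln_Gamma x + ln (x::real)"
proof -
  assume x: "0 < x"
  then have "x \<notin> \<int>\<^sub>\<le>\<^sub>0" by (auto elim!: nonpos_Ints_cases)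
  then show ?thesis
    using x by (simp add: ln_Gamma_real_pos Gamma_plus1 ln_mult Gamma_eq_zero_iff)
qed

text \<open>The increment of \<open>ln_Gamma\<close> over a unit interval is \<open>ln x\<close>, so
  by the mean value theorem it is a value of \<open>Digamma\<close> inside the interval;
  monotonicity moves this value to either endpoint.\<close>

lemma Digamma_le_ln:
  assumes "0 < (x::real)"
  shows "Digamma x \<le> ln x" "ln x \<le> Digamma (x + 1)"
proof -
  have "\<exists>z>x. z < x + 1 \<and> ln_Gamma (x + 1) - ln_Gamma x = (x + 1 - x) * Digamma z"
    using assms by (intro MVT2) (auto intro!: derivative_eq_intros simp: nonpos_Ints_def)
  then obtain z where "x < z" "z < x + 1" "ln x = Digamma z"
    using assms by (auto simp: ln_Gamma_plus1)
  then show "Digamma x \<le> ln x" "ln x \<le> Digamma (x + 1)"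
    using assms by (auto intro!: Digamma_real_mono)
qed

text \<open>A crude Stirling formula, obtained by comparing derivatives. An error of size
  \<open>ln x\<close> is good enough, because it will be evaluated at \<open>2 ^ k * z\<close> and
  divided by \<open>2 ^ k\<close>.\<close>

lemma ln_Gamma_bounds:
  assumes "1 \<le> (x::real)"
  shows "ln_Gamma x \<le> x * ln x - x + 1" "x * ln x - x + 1 - ln x \<le> ln_Gamma x"
proof -
  have "ln_Gamma x - (x * ln x - x) \<le> ln_Gamma 1 - (1 * ln 1 - 1)"
    using assms
    by (intro DERIV_nonpos_imp_nonincreasing[of 1 x "\<lambda>x. ln_Gamma x - (x * ln x - x)"] exI conjI)
      (auto intro!: derivative_eq_intros simp: nonpos_Ints_def Digamma_le_ln)
  then show "ln_Gamma x \<le> x * ln x - x + 1" by (simp add: ln_Gamma_real_pos)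
  have "ln_Gamma (1 + 1) - (1 * ln 1 - 1) \<le> ln_Gamma (x + 1) - (x * ln x - x)"
    using assms
    by (intro DERIV_nonneg_imp_nondecreasing[of 1 x "\<lambda>x. ln_Gamma (x + 1) - (x * ln x - x)"] exI conjI)
      (auto intro!: derivative_eq_intros simp: nonpos_Ints_def Digamma_le_ln)
  then show "x * ln x - x + 1 - ln x \<le> ln_Gamma x"
    using ln_Gamma_plus1[of x] ln_Gamma_plus1[of 1] assms by (simp add: ln_Gamma_real_pos[of 1])
qed

section \<open>Beta exponents and the iterated duplication formula\<close>

lemma ln_Gamma_duplication:
  assumes "0 < (x::real)"
  shows "ln_Gamma x + ln_Gamma (x + 1/2) = (1 - 2 * x) * ln 2 + ln pi / 2 + ln_Gamma (2 * x)"
proof -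
  have "complex_of_real x \<notin> \<int>\<^sub>\<le>\<^sub>0" "complex_of_real (x + 1/2) \<notin> \<int>\<^sub>\<le>\<^sub>0"
    using assms by (auto elim!: nonpos_Ints_cases simp: complex_eq_iff)
  then have "complex_of_real (Gamma x * Gamma (x + 1/2)) =
      complex_of_real (exp ((1 - 2 * x) * ln 2) * sqrt pi * Gamma (2 * x))"
    using Gamma_legendre_duplication[of "of_real x"]
    by (simp add: Gamma_complex_of_real[symmetric] exp_of_real[symmetric])
  then have "Gamma x * Gamma (x + 1/2) = exp ((1 - 2 * x) * ln 2) * sqrt pi * Gamma (2 * x)"
    by (simp only: of_real_eq_iff)
  then have "ln (Gamma x * Gamma (x + 1/2)) = ln (exp ((1 - 2 * x) * ln 2) * sqrt pi * Gamma (2 * x))"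
    by simp
  then show ?thesis
    using assms by (simp add: ln_Gamma_real_pos ln_mult ln_sqrt Gamma_real_pos less_imp_neq[THEN not_sym])
qed

text \<open>The exponent belongs to the \<open>c\<close>-th power of a Beta variable with parameters
  \<open>c + 1/2\<close> and \<open>1/2\<close>. Infinite divisibility comes from the Euler limit
  for \<open>ln_Gamma\<close>, which turns it into a limit of sums of the logarithmic ratios treated
  above.\<close>

lemma infdiv_exponent_beta_half:
  fixes c :: real
  assumes "0 < c"
  defines "E \<equiv> \<lambda>x::real. ln_Gamma (x + 1/2) - ln_Gamma (x + 1)"
  shows "infdiv_exponent (\<lambda>n. E (c * (real n + 1)) - E c)"
proof (rule infdiv_exponent_limit)
  \<comment> \<open>The points \<open>- a j\<close> and \<open>- b j\<close> are the poles, as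
    functions of \<open>n\<close>, of Gamma at \<open>c * (n + 1) + 1/2\<close> and at
    \<open>c * (n + 1) + 1\<close>.\<close>
  define a where "a = (\<lambda>j::nat. (c + 1/2 + real j) / c)"
  define b where "b = (\<lambda>j::nat. (c + 1 + real j) / c)"
  define g where "g = (\<lambda>k n. \<Sum>j\<le>k. ln ((real n + b j) / (real n + a j)) - ln (b j / a j))"
  show "infdiv_exponent (g k)" for k
    unfolding g_def using assms
    by (intro infdiv_exponent_sum infdiv_exponent_ln_ratio) (auto simp: a_def b_def divide_right_mono)
  fix n
  define E' where "E' = (\<lambda>k x::real. ln_Gamma_series (x + 1/2) k - ln_Gamma_series (x + 1) k)"
  \<comment> \<open>The divergent term \<open>- ln k / 2\<close> is independent of \<open>x\<close>,
    so it drops out of the difference of two values of \<open>E'\<close>.\<close>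
  have E': "E' k x = - ln (real k) / 2 + (\<Sum>j\<le>k. ln ((x + 1 + real j) / (x + 1/2 + real j)))"
    if "0 < x" for k x
  proof -
    have "(\<Sum>j\<le>k. ln ((x + 1 + real j) / (x + 1/2 + real j))) =
        ln ((x + 1) / (x + 1/2)) + (\<Sum>j=1..k. ln ((x + 1 + real j) / (x + 1/2 + real j)))"
      unfolding atMost_atLeast0 by (subst sum.atLeast_Suc_atMost) auto
    also have "(\<Sum>j=1..k. ln ((x + 1 + real j) / (x + 1/2 + real j))) =
        (\<Sum>j=1..k. ln ((x + 1) / real j + 1) - ln ((x + 1/2) / real j + 1))"
    proof (rule sum.cong[OF refl])
      fix j assume "j \<in> {1..k}"
      then have j: "0 < real j" by simp
      have "(x + 1 + real j) / (x + 1/2 + real j) = ((x + 1) / real j + 1) / ((x + 1/2) / real j + 1)"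
      proof -
        have "(x + 1) / real j + 1 = (x + 1 + real j) / real j"
          "(x + 1/2) / real j + 1 = (x + 1/2 + real j) / real j"
          using j by (simp_all add: add_divide_distrib)
        then show ?thesis using j by simp
      qed
      moreover have "0 < (x + 1) / real j + 1" "0 < (x + 1/2) / real j + 1"
        using j that by (auto intro!: add_pos_pos divide_pos_pos)
      ultimately show "ln ((x + 1 + real j) / (x + 1/2 + real j)) =
          ln ((x + 1) / real j + 1) - ln ((x + 1/2) / real j + 1)"
        by (auto simp only: ln_div split: if_splits)
    qed
    finally show ?thesis
      using that by (simp add: E'_def ln_Gamma_series_def sum_subtractf ln_div algebra_simps)
  qed
  have w: "0 < c * (real n + 1)" using assms by simp
  have "g k n = E' k (c * (real n + 1)) - E' k c" for k
  proof -
    have "(real n + b j) / (real n + a j) = (c * (real n + 1) + 1 + real j) / (c * (real n + 1) + 1/2 + real j)"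
      "b j / a j = (c + 1 + real j) / (c + 1/2 + real j)" for j
    proof -
      have "real n + b j = (c * (real n + 1) + 1 + real j) / c"
        "real n + a j = (c * (real n + 1) + 1/2 + real j) / c"
        using assms(1) by (simp_all add: a_def b_def field_simps)
      then show "(real n + b j) / (real n + a j) = (c * (real n + 1) + 1 + real j) / (c * (real n + 1) + 1/2 + real j)"
        using assms(1) by simp
      show "b j / a j = (c + 1 + real j) / (c + 1/2 + real j)"
        using assms(1) by (simp add: a_def b_def)
    qed
    then show ?thesis
      unfolding g_def E'[OF w] E'[OF assms(1)] sum_subtractf by simp
  qed
  moreover have "(\<lambda>k. E' k x) \<longlonglongrightarrow> E x" if "0 < x" for x
    unfolding E'_def E_def by (intro tendsto_diff ln_Gamma_real_LIMSEQ) (use that in auto)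
  ultimately show "(\<lambda>k. g k n) \<longlonglongrightarrow> E (c * (real n + 1)) - E c"
    using w assms(1) by (simp add: tendsto_diff)
qed

text \<open>Iterating the duplication formula and comparing with the growth of \<open>ln_Gamma\<close> writes
  \<open>z ln z - z - ln_Gamma z - ln z\<close> as a series of Beta exponents, up to a constant.\<close>

lemma ln_Gamma_dyadic_limit:
  fixes x y :: real
  assumes "1 \<le> x" "1 \<le> y"
  defines "E \<equiv> \<lambda>x::real. ln_Gamma (x + 1/2) - ln_Gamma (x + 1)"
    and "F \<equiv> \<lambda>x::real. x * ln x - x - ln_Gamma x - ln x"
  shows "(\<lambda>k. \<Sum>i<k. (1/2) ^ Suc i * (E (2 ^ i * x) - E (2 ^ i * y))) \<longlonglongrightarrow> F x - F y"
proof -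
  \<comment> \<open>Duplication expresses \<open>L (Suc i) z - L i z\<close> through
    \<open>E\<close>, so the sum over \<open>i\<close> telescopes; the halving in \<open>L\<close>
    balances the doubling of the argument.\<close>
  define L where "L = (\<lambda>k z::real. (1/2) ^ k * ln_Gamma (2 ^ k * z))"
  \<comment> \<open>Collects all terms that do not depend on \<open>z\<close>; they cancel when the
    values at \<open>x\<close> and \<open>y\<close> are compared.\<close>
  define \<kappa> where "\<kappa> = (\<lambda>i::nat. (1/2) ^ Suc i * real i * ln 2 - (1/2) ^ i * (ln 2 / 2 + ln pi / 4))"
  have step: "L (Suc i) z - L i z = (1/2) ^ Suc i * E (2 ^ i * z) + (1/2) ^ Suc i * ln z + z * ln 2 + \<kappa> i"
    if "1 \<le> z" for i z
  proof -
    define w where "w = 2 ^ i * z"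
    have w: "0 < w" using that by (simp add: w_def)
    have "ln_Gamma (2 * w) / 2 - ln_Gamma w = E w / 2 + ln w / 2 + (w - 1/2) * ln 2 - ln pi / 4"
      using ln_Gamma_duplication[OF w] ln_Gamma_plus1[OF w] by (simp add: E_def field_simps)
    moreover have "L (Suc i) z - L i z = (1/2) ^ i * (ln_Gamma (2 * w) / 2 - ln_Gamma w)"
      by (simp add: L_def w_def algebra_simps)
    ultimately have "L (Suc i) z - L i z = (1/2) ^ i * (E w / 2 + ln w / 2 + (w - 1/2) * ln 2 - ln pi / 4)"
      by (simp only:)
    also have "\<dots> = (1/2) ^ Suc i * E w + (1/2) ^ Suc i * ln w + (1/2) ^ i * w * ln 2
        - (1/2) ^ i * (ln 2 / 2 + ln pi / 4)"
      by (simp add: algebra_simps)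
    also have "ln w = ln z + i * ln 2" using that by (simp add: w_def ln_mult ln_realpow)
    also have "(1/2) ^ i * w = z" by (simp add: w_def power_divide)
    finally show ?thesis by (simp add: \<kappa>_def w_def[symmetric] distrib_left)
  qed
  have sum: "(\<Sum>i<k. (1/2) ^ Suc i * E (2 ^ i * z)) =
      L k z - ln_Gamma z - (1 - (1/2) ^ k) * ln z - k * (z * ln 2) - (\<Sum>i<k. \<kappa> i)" if "1 \<le> z" for k z
  proof (induction k)
    case (Suc k)
    then show ?case using step[OF that, of k] by (simp add: algebra_simps)
  qed (simp add: L_def)
  have lim: "(\<lambda>k. L k z - (z * ln z + k * (z * ln 2) - z)) \<longlonglongrightarrow> 0" if "1 \<le> z" for z
  proof (rule tendsto_sandwich)
    have 1: "1 \<le> 2 ^ k * z" for k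
      using that mult_mono[of 1 "2 ^ k" 1 z] by simp
    have 2: "(1/2) ^ k * (2 ^ k * z * ln (2 ^ k * z) - 2 ^ k * z) = z * ln z + k * (z * ln 2) - z" for k
      using that by (simp add: ln_mult ln_realpow power_divide algebra_simps)
    show "\<forall>\<^sub>F k in sequentially. L k z - (z * ln z + k * (z * ln 2) - z) \<le> (1/2) ^ k"
    proof (intro always_eventually allI)
      fix k
      show "L k z - (z * ln z + k * (z * ln 2) - z) \<le> (1/2) ^ k"
        unfolding 2[symmetric] L_def
        using mult_left_mono[OF ln_Gamma_bounds(1)[OF 1[of k]], of "(1/2) ^ k"] by (simp add: algebra_simps)
    qed
    show "\<forall>\<^sub>F k in sequentially. (1/2) ^ k * (1 - ln z - k * ln 2) \<le> L k z - (z * ln z + k * (z * ln 2) - z)"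
    proof (intro always_eventually allI)
      fix k
      have "ln (2 ^ k * z) = ln z + k * ln 2" using that by (simp add: ln_mult ln_realpow)
      then show "(1/2) ^ k * (1 - ln z - k * ln 2) \<le> L k z - (z * ln z + k * (z * ln 2) - z)"
        unfolding 2[symmetric] L_def
        using mult_left_mono[OF ln_Gamma_bounds(2)[OF 1[of k]], of "(1/2) ^ k"] by (simp add: algebra_simps)
    qed
  qed real_asymp+
  have "(\<lambda>k. (L k x - (x * ln x + k * (x * ln 2) - x)) - (L k y - (y * ln y + k * (y * ln 2) - y))
      + (1/2) ^ k * (ln x - ln y) + (F x - F y)) \<longlonglongrightarrow> 0 - 0 + 0 * (ln x - ln y) + (F x - F y)"
    using assms(1,2) by (intro tendsto_intros lim) auto
  moreover have "(\<Sum>i<k. (1/2) ^ Suc i * (E (2 ^ i * x) - E (2 ^ i * y))) =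
      (L k x - (x * ln x + k * (x * ln 2) - x)) - (L k y - (y * ln y + k * (y * ln 2) - y))
      + (1/2) ^ k * (ln x - ln y) + (F x - F y)" for k
    unfolding right_diff_distrib sum_subtractf sum[OF assms(1)] sum[OF assms(2)] F_def
    by (simp add: algebra_simps)
  ultimately show ?thesis by simp
qed

text \<open>Up to a linear term, the increment of \<open>F\<close> from \<open>t\<close> to
  \<open>t * (n + 1)\<close> is too large by \<open>(t - 1) * ln (n + 1)\<close>. The exponent
  \<open>- ln (n + 1)\<close> removes this excess with the weight \<open>t - 1\<close>, which is
  nonnegative because \<open>t\<close> is at least 1.\<close>

lemma infdiv_exponent_power_over_Gamma:
  assumes "1 \<le> t"
  shows "infdiv_exponent (\<lambda>n. t * real n * ln (real n + 1) - (ln_Gamma (t * (real n + 1)) - ln_Gamma t))"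
proof -
  define E where "E = (\<lambda>x::real. ln_Gamma (x + 1/2) - ln_Gamma (x + 1))"
  define F where "F = (\<lambda>x::real. x * ln x - x - ln_Gamma x - ln x)"
  have "infdiv_exponent (\<lambda>n. F (t * (real n + 1)) - F t)"
  proof (rule infdiv_exponent_limit)
    show "infdiv_exponent (\<lambda>n. \<Sum>i<k. (1/2) ^ Suc i * (E (2 ^ i * t * (real n + 1)) - E (2 ^ i * t)))" for k
      unfolding E_def
      by (intro infdiv_exponent_sum infdiv_exponent_scale infdiv_exponent_beta_half) (use assms in auto)
    fix n
    have "1 * 1 \<le> t * (real n + 1)" using assms by (intro mult_mono) auto
    then show "(\<lambda>k. \<Sum>i<k. (1/2) ^ Suc i * (E (2 ^ i * t * (real n + 1)) - E (2 ^ i * t)))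
        \<longlonglongrightarrow> F (t * (real n + 1)) - F t"
      using ln_Gamma_dyadic_limit[of "t * (real n + 1)" t] assms
      by (simp add: E_def F_def mult.assoc)
  qed
  from infdiv_exponent_add[OF infdiv_exponent_add[OF this
      infdiv_exponent_scale[OF infdiv_exponent_minus_ln[of 1], of "t - 1"]]
      infdiv_exponent_linear[of "t * (1 - ln t)"]]
  have "infdiv_exponent (\<lambda>n. F (t * (real n + 1)) - F t + (t - 1) * (ln 1 - ln (real n + 1))
      + t * (1 - ln t) * real n)"
    using assms by simp
  moreover have "F (t * (real n + 1)) - F t + (t - 1) * (ln 1 - ln (real n + 1))
      + t * (1 - ln t) * real n =
      t * real n * ln (real n + 1) - (ln_Gamma (t * (real n + 1)) - ln_Gamma t)" for n
  proof -
    have "ln (t * (real n + 1)) = ln t + ln (real n + 1)" using assms by (simp add: ln_mult)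
    then show ?thesis unfolding F_def by (simp add: algebra_simps)
  qed
  ultimately show ?thesis by simp
qed

section \<open>Exponential transforms and determinacy\<close>

text \<open>The absolute values of the terms add up to exactly the function assumed integrable, so
  sum and integral may be exchanged. At \<open>z = 0\<close> the coefficients are moments; for
  general \<open>z\<close> the expansion gives holomorphy.\<close>

lemma exp_transform_sums:
  fixes X :: "'a \<Rightarrow> real" and z h :: complex
  assumes [measurable]: "X \<in> borel_measurable M"
    and int: "integrable M (\<lambda>\<omega>. exp (Re z * X \<omega> + norm h * \<bar>X \<omega>\<bar>))"
  shows "(\<lambda>k. h ^ k / fact k * (\<integral>\<omega>. of_real (X \<omega>) ^ k * exp (z * of_real (X \<omega>)) \<partial>M))
    sums (\<integral>\<omega>. exp ((z + h) * of_real (X \<omega>)) \<partial>M)"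
proof -
  define f where "f = (\<lambda>k \<omega>. h ^ k / fact k * (of_real (X \<omega>) ^ k * exp (z * of_real (X \<omega>))))"
  have [measurable]: "f k \<in> borel_measurable M" for k unfolding f_def by measurable
  have norm_f: "norm (f k \<omega>) = exp (Re z * X \<omega>) * ((norm h * \<bar>X \<omega>\<bar>) ^ k /\<^sub>R fact k)" for k \<omega>
    by (simp add: f_def norm_mult norm_divide norm_power power_mult_distrib divide_inverse norm_inverse)
  have norm_sums: "(\<lambda>k. norm (f k \<omega>)) sums exp (Re z * X \<omega> + norm h * \<bar>X \<omega>\<bar>)" for \<omega>
    unfolding norm_f exp_add by (intro sums_mult exp_converges)
  have f_sums: "(\<lambda>k. f k \<omega>) sums exp ((z + h) * of_real (X \<omega>))" for \<omega>
  proof -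
    have "(\<lambda>k. exp (z * of_real (X \<omega>)) * ((h * of_real (X \<omega>)) ^ k /\<^sub>R fact k)) sums
        (exp (z * of_real (X \<omega>)) * exp (h * of_real (X \<omega>)))"
      by (intro sums_mult exp_converges)
    then show ?thesis
      by (simp add: f_def power_mult_distrib scaleR_conv_of_real divide_inverse mult_ac
          distrib_right exp_add)
  qed
  have sum_le: "(\<Sum>k<n. norm (f k \<omega>)) \<le> exp (Re z * X \<omega> + norm h * \<bar>X \<omega>\<bar>)" for n \<omega>
    using norm_sums[of \<omega>] sum_le_suminf[of "\<lambda>k. norm (f k \<omega>)" "{..<n}"] by (auto simp: sums_iff)
  have le: "norm (f k \<omega>) \<le> exp (Re z * X \<omega> + norm h * \<bar>X \<omega>\<bar>)" for k \<omega>
    by (rule order_trans[OF _ sum_le[of _ "Suc k"]]) (simp add: sum_nonneg)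
  have int_f: "integrable M (f k)" for k
    by (rule Bochner_Integration.integrable_bound[OF int]) (use le in \<open>auto intro!: AE_I2\<close>)
  have "(\<lambda>k. \<integral>\<omega>. f k \<omega> \<partial>M) sums (\<integral>\<omega>. (\<Sum>k. f k \<omega>) \<partial>M)"
  proof (rule sums_integral[OF int_f])
    show "AE \<omega> in M. summable (\<lambda>k. norm (f k \<omega>))"
      using norm_sums by (auto simp: sums_iff)
    show "summable (\<lambda>k. \<integral>\<omega>. norm (f k \<omega>) \<partial>M)"
    proof (rule summableI_nonneg_bounded)
      show "(\<Sum>k<n. \<integral>\<omega>. norm (f k \<omega>) \<partial>M) \<le> (\<integral>\<omega>. exp (Re z * X \<omega> + norm h * \<bar>X \<omega>\<bar>) \<partial>M)" for n
      proof -
        have "(\<integral>\<omega>. (\<Sum>k<n. norm (f k \<omega>)) \<partial>M) \<le> (\<integral>\<omega>. exp (Re z * X \<omega> + norm h * \<bar>X \<omega>\<bar>) \<partial>M)"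
          using int_f int sum_le by (intro integral_mono) auto
        then show ?thesis using int_f by simp
      qed
    qed simp
  qed
  moreover have "(\<Sum>k. f k \<omega>) = exp ((z + h) * of_real (X \<omega>))" for \<omega>
    using f_sums by (simp add: sums_iff)
  moreover have "(\<integral>\<omega>. f k \<omega> \<partial>M) =
      h ^ k / fact k * (\<integral>\<omega>. of_real (X \<omega>) ^ k * exp (z * of_real (X \<omega>)) \<partial>M)" for k
    unfolding f_def by (rule integral_mult_right_zero)
  ultimately show ?thesis by simp
qed

lemma integrable_exp_add_abs:
  fixes X :: "'a \<Rightarrow> real"
  assumes [measurable]: "X \<in> borel_measurable M"
    and "integrable M (\<lambda>\<omega>. exp ((u - r) * X \<omega>))" "integrable M (\<lambda>\<omega>. exp ((u + r) * X \<omega>))"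
  shows "integrable M (\<lambda>\<omega>. exp (u * X \<omega> + r * \<bar>X \<omega>\<bar>))"
proof (rule Bochner_Integration.integrable_bound[OF Bochner_Integration.integrable_add[OF assms(2,3)]])
  have "exp (u * x + r * \<bar>x\<bar>) \<le> exp ((u - r) * x) + exp ((u + r) * x)" for x
    by (cases "0 \<le> x") (simp_all add: algebra_simps)
  then show "AE \<omega> in M. norm (exp (u * X \<omega> + r * \<bar>X \<omega>\<bar>)) \<le>
      norm (exp ((u - r) * X \<omega>) + exp ((u + r) * X \<omega>))"
    by (auto intro!: AE_I2)
qed simp

text \<open>Around each point the transform equals its Taylor series: integrability at the two real
  points \<open>Re z - norm (w - z)\<close> and \<open>Re z + norm (w - z)\<close> supplies the
  majorant.\<close>

lemma exp_transform_holomorphic: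
  fixes X :: "'a \<Rightarrow> real"
  assumes X [measurable]: "X \<in> borel_measurable M"
    and "open A" and int: "\<And>u. u \<in> A \<Longrightarrow> integrable M (\<lambda>\<omega>. exp (u * X \<omega>))"
  shows "(\<lambda>z. \<integral>\<omega>. exp (z * of_real (X \<omega>)) \<partial>M) holomorphic_on {z. Re z \<in> A}"
proof -
  have "\<exists>r>0. (\<lambda>z. \<integral>\<omega>. exp (z * of_real (X \<omega>)) \<partial>M) holomorphic_on ball z r" if z: "Re z \<in> A" for z
  proof -
    obtain r where r: "0 < r" "cball (Re z) r \<subseteq> A"
      using open_contains_cball[THEN iffD1, OF \<open>open A\<close>, THEN bspec, OF z] by auto
    have "(\<lambda>z. \<integral>\<omega>. exp (z * of_real (X \<omega>)) \<partial>M) holomorphic_on ball z r"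
    proof (rule power_series_holomorphic)
      fix w assume "w \<in> ball z r"
      then have "Re z - norm (w - z) \<in> A" "Re z + norm (w - z) \<in> A"
        using r(2) by (auto simp: subset_iff dist_norm norm_minus_commute)
      then have "integrable M (\<lambda>\<omega>. exp (Re z * X \<omega> + norm (w - z) * \<bar>X \<omega>\<bar>))"
        using int by (intro integrable_exp_add_abs) auto
      from exp_transform_sums[OF X this]
      show "(\<lambda>k. (\<integral>\<omega>. of_real (X \<omega>) ^ k * exp (z * of_real (X \<omega>)) \<partial>M) / fact k * (w - z) ^ k)
          sums (\<integral>\<omega>. exp (w * of_real (X \<omega>)) \<partial>M)"
        by (simp add: mult_ac)
    qed
    with r(1) show ?thesis by blast
  qed
  then show ?thesis by (intro analytic_imp_holomorphic) (auto simp: analytic_on_def)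
qed

lemma holomorphic_eq_from_reals:
  assumes "f holomorphic_on S" "g holomorphic_on S" "open S" "connected S"
    and "a < b" and S: "\<And>u. a < u \<Longrightarrow> u < b \<Longrightarrow> of_real u \<in> S"
    and eq: "\<And>u. a < u \<Longrightarrow> u < b \<Longrightarrow> f (of_real u) = g (of_real u)"
    and "w \<in> S"
  shows "f w = g w"
proof -
  define c where "c = (a + b) / 2"
  have c: "a < c" "c < b" using \<open>a < b\<close> by (auto simp: c_def)
  have "c islimpt {a<..<b}" using c by (intro interior_limit_point) simp
  then have "complex_of_real c islimpt of_real ` {a<..<b}"
    unfolding islimpt_sequential
  proof (elim exE conjE)
    fix s assume s: "\<forall>n. s n \<in> {a<..<b} - {c}" "s \<longlonglongrightarrow> c"
    then show "\<exists>f. (\<forall>n. f n \<in> complex_of_real ` {a<..<b} - {complex_of_real c}) \<and> f \<longlonglongrightarrow> complex_of_real c"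
      by (intro exI[of _ "\<lambda>n. of_real (s n)"]) (auto intro!: tendsto_of_real)
  qed
  then have "f w - g w = 0"
    using assms c
    by (intro analytic_continuation[of "\<lambda>z. f z - g z" S "of_real ` {a<..<b}" "of_real c" w])
      (auto intro!: holomorphic_intros)
  then show ?thesis by simp
qed

lemma convex_Re_vimage: "convex A \<Longrightarrow> convex {z. Re z \<in> A}"
  using convex_linear_vimage[OF bounded_linear.linear[OF bounded_linear_Re]]
  by (simp add: vimage_def)

lemma open_Re_vimage: "open A \<Longrightarrow> open {z. Re z \<in> A}"
  using open_vimage[OF _ continuous_on_Re[OF continuous_on_id], of A] by (simp add: vimage_def)

text \<open>Identity theorem on a vertical strip: a formula checked on one real interval holds
  throughout the strip. This evaluates oscillating integrals without contour integration.\<close>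

lemma exp_transform_eqI:
  fixes X :: "'a \<Rightarrow> real"
  assumes "X \<in> borel_measurable M" "open A" "convex A"
    and "\<And>u. u \<in> A \<Longrightarrow> integrable M (\<lambda>\<omega>. exp (u * X \<omega>))"
    and "g holomorphic_on {z. Re z \<in> A}"
    and "a < b" "{a<..<b} \<subseteq> A"
    and "\<And>u. a < u \<Longrightarrow> u < b \<Longrightarrow> of_real (\<integral>\<omega>. exp (u * X \<omega>) \<partial>M) = g (of_real u)"
    and "Re z \<in> A"
  shows "(\<integral>\<omega>. exp (z * of_real (X \<omega>)) \<partial>M) = g z"
proof (rule holomorphic_eq_from_reals[OF exp_transform_holomorphic[OF assms(1,2,4)] assms(5)])
  show "(\<integral>\<omega>. exp (of_real u * of_real (X \<omega>)) \<partial>M) = g (of_real u)" if "a < u" "u < b" for u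
    using assms(8)[OF that] integral_complex_of_real[of M "\<lambda>\<omega>. exp (u * X \<omega>)"]
    by (simp add: exp_of_real[symmetric])
qed (use assms in \<open>auto intro: open_Re_vimage convex_connected convex_Re_vimage\<close>)

section \<open>Determinacy from exponential moments\<close>

text \<open>The moments fix the exponential transform near 0 through its power series, analytic
  continuation carries the equality to the imaginary axis, and there it is equality of
  characteristic functions.\<close>

lemma real_distribution_determinate:
  assumes M: "real_distribution M" and N: "real_distribution N" and "0 < r"
    and intM: "integrable M (\<lambda>x. exp (r * \<bar>x\<bar>))" and intN: "integrable N (\<lambda>x. exp (r * \<bar>x\<bar>))"
    and eq: "\<And>n. (\<integral>x. x ^ n \<partial>M) = (\<integral>x. x ^ n \<partial>N)"
  shows "M = N"
proof (rule Levy_uniqueness[OF M N], rule ext)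
  fix t
  have int: "integrable L (\<lambda>x. exp (u * x))"
    if "real_distribution L" "integrable L (\<lambda>x. exp (r * \<bar>x\<bar>))" "\<bar>u\<bar> < r" for L u
  proof -
    interpret real_distribution L by fact
    have "u * x \<le> r * \<bar>x\<bar>" for x
    proof -
      have "u * x \<le> \<bar>u\<bar> * \<bar>x\<bar>" by (metis abs_ge_self abs_mult)
      also have "\<dots> \<le> r * \<bar>x\<bar>" using that by (intro mult_right_mono) auto
      finally show ?thesis .
    qed
    then show ?thesis
      by (intro Bochner_Integration.integrable_bound[OF that(2)]) (auto intro!: AE_I2)
  qed
  have ser: "(\<lambda>k. of_real u ^ k / fact k * of_real (\<integral>x. x ^ k \<partial>L)) sums
      (\<integral>x. exp (of_real u * complex_of_real x) \<partial>L)"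
    if L: "real_distribution L" "integrable L (\<lambda>x. exp (r * \<bar>x\<bar>))" "\<bar>u\<bar> < r" for L u
  proof -
    interpret real_distribution L by fact
    have "integrable L (\<lambda>x. exp (0 * x + \<bar>u\<bar> * \<bar>x\<bar>))"
      using int[OF L(1,2), of "-\<bar>u\<bar>"] int[OF L(1,2), of "\<bar>u\<bar>"] L(3)
      by (intro integrable_exp_add_abs) auto
    then have "(\<lambda>k. of_real u ^ k / fact k * (\<integral>x. complex_of_real x ^ k * exp (0 * of_real x) \<partial>L))
        sums (\<integral>x. exp ((0 + of_real u) * of_real x) \<partial>L)"
      using exp_transform_sums[of "\<lambda>x. x" L 0 "of_real u"] by simp
    moreover have "(\<integral>x. complex_of_real x ^ k * exp (0 * of_real x) \<partial>L) = complex_of_real (\<integral>x. x ^ k \<partial>L)" for k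
      by (simp flip: of_real_power)
    ultimately show ?thesis by simp
  qed
  have eq': "(\<integral>x. exp (of_real u * complex_of_real x) \<partial>M) = (\<integral>x. exp (of_real u * complex_of_real x) \<partial>N)"
    if "\<bar>u\<bar> < r" for u
    using sums_unique2[OF ser[OF M intM that] ser[OF N intN that, unfolded eq[symmetric]]] .
  interpret M: real_distribution M by fact
  interpret N: real_distribution N by fact
  let ?S = "{z. Re z \<in> {-r<..<r}}"
  have "(\<integral>x. exp ((\<i> * of_real t) * complex_of_real x) \<partial>M) =
      (\<integral>x. exp ((\<i> * of_real t) * complex_of_real x) \<partial>N)"
  proof (rule holomorphic_eq_from_reals[where S = ?S and a = "-r" and b = r
        and f = "\<lambda>z. \<integral>x. exp (z * complex_of_real x) \<partial>M"
        and g = "\<lambda>z. \<integral>x. exp (z * complex_of_real x) \<partial>N"])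
    show "(\<lambda>z. \<integral>x. exp (z * complex_of_real x) \<partial>M) holomorphic_on ?S"
      by (rule exp_transform_holomorphic) (auto intro!: int[OF M intM] simp: abs_less_iff)
    show "(\<lambda>z. \<integral>x. exp (z * complex_of_real x) \<partial>N) holomorphic_on ?S"
      by (rule exp_transform_holomorphic) (auto intro!: int[OF N intN] simp: abs_less_iff)
    show "open ?S" "connected ?S"
      by (intro open_Re_vimage convex_connected convex_Re_vimage; simp)+
    show "- r < r" using \<open>0 < r\<close> by simp
  qed (use \<open>0 < r\<close> eq' in \<open>auto simp: abs_less_iff\<close>)
  then show "char M t = char N t"
    by (simp add: char_def mult_ac)
qed

text \<open>The series is the termwise integral of the expansion of
  \<open>cosh (r * sqrt x)\<close>, all of whose terms are nonnegative on the half-line; twice this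
  function dominates the exponential.\<close>

lemma stieltjes_exp_sqrt_integrable:
  assumes "stieltjes_solution m \<nu>" "m 0 = 1" "0 < r"
    and sum: "summable (\<lambda>n. r ^ (2 * n) / fact (2 * n) * m n)"
  shows "integrable \<nu> (\<lambda>x. exp (r * \<bar>sqrt x\<bar>))"
proof -
  note \<nu> = stieltjes_solutionD[OF assms(1,2)]
  interpret real_distribution \<nu> by fact
  define f where "f = (\<lambda>n x. r ^ (2 * n) / fact (2 * n) * x ^ n)"
  have f_int: "integrable \<nu> (f n)" for n
    unfolding f_def by (intro integrable_mult_right \<nu>)
  have f_nonneg: "0 \<le> f n x" if "0 \<le> x" for n x
    using that \<open>0 < r\<close> by (simp add: f_def)
  have f_sums: "(\<lambda>n. f n x) sums cosh (r * sqrt x)" if "0 \<le> x" for x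
  proof -
    define c where "c = (\<lambda>n. if even n then (r * sqrt x) ^ n /\<^sub>R fact n else 0)"
    have "(\<lambda>n. c (2 * n)) sums cosh (r * sqrt x)"
      by (subst sums_mono_reindex)
        (use cosh_converges[of "r * sqrt x"] in \<open>auto simp: strict_mono_def c_def elim!: evenE\<close>)
    moreover have "c (2 * n) = f n x" for n
      using that by (simp add: c_def f_def power_mult_distrib power_mult divide_inverse)
    ultimately show ?thesis by simp
  qed
  have norm_eq: "(\<integral>x. norm (f n x) \<partial>\<nu>) = r ^ (2 * n) / fact (2 * n) * m n" for n
  proof -
    have "(\<integral>x. norm (f n x) \<partial>\<nu>) = (\<integral>x. f n x \<partial>\<nu>)"
    proof (rule integral_cong_AE)
      show "AE x in \<nu>. norm (f n x) = f n x" using \<nu>(2) by eventually_elim (simp add: f_nonneg)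
    qed (use f_int in auto)
    then show ?thesis by (simp add: f_def \<nu>(4))
  qed
  have *: "AE x in \<nu>. summable (\<lambda>n. norm (f n x))"
    using \<nu>(2)
  proof eventually_elim
    case (elim x)
    then have "norm (f n x) = f n x" for n using f_nonneg by simp
    then show ?case using f_sums[OF elim] by (simp add: sums_iff)
  qed
  have "integrable \<nu> (\<lambda>x. \<Sum>n. f n x)"
    using f_int * by (rule integrable_suminf) (simp only: norm_eq sum)
  then have int: "integrable \<nu> (\<lambda>x. 2 * (\<Sum>n. f n x))" by simp
  show ?thesis
  proof (rule Bochner_Integration.integrable_bound[OF int])
    show "AE x in \<nu>. norm (exp (r * \<bar>sqrt x\<bar>)) \<le> norm (2 * (\<Sum>n. f n x))"
      using \<nu>(2)
    proof eventually_elim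
      case (elim x)
      then have "2 * (\<Sum>n. f n x) = exp (r * sqrt x) + exp (- (r * sqrt x))"
        using sums_unique[OF f_sums[OF elim]] by (simp add: cosh_def)
      then have "norm (2 * (\<Sum>n. f n x)) = exp (r * sqrt x) + exp (- (r * sqrt x))"
        by (simp only:) simp
      then show ?case using elim by (simp only:) simp
    qed
  qed simp
qed

text \<open>A measure on the half-line is recovered from the symmetric law of plus or minus the square
  root, whose even moments are the given ones.\<close>

lemma stieltjes_determinate:
  assumes sol: "stieltjes_solution m \<nu>1" "stieltjes_solution m \<nu>2" and m: "m 0 = 1" and r: "0 < r"
    and sum: "summable (\<lambda>n. r ^ (2 * n) / fact (2 * n) * m n)"
  shows "\<nu>1 = \<nu>2"
proof -
  let ?B = "measure_pmf (bernoulli_pmf (1/2))"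
  define w :: "real \<times> bool \<Rightarrow> real" where "w = (\<lambda>p. sqrt (fst p) * (if snd p then 1 else - 1))"
  define S where "S = (\<lambda>\<nu>. distr (\<nu> \<Otimes>\<^sub>M ?B) borel w)"
  have S: "real_distribution (S \<nu>) \<and> integrable (S \<nu>) (\<lambda>x. exp (r * \<bar>x\<bar>)) \<and>
      (\<forall>n. (\<integral>x. x ^ n \<partial>S \<nu>) = (if even n then m (n div 2) else 0)) \<and>
      distr (S \<nu>) borel (\<lambda>x. x\<^sup>2) = \<nu>" if "stieltjes_solution m \<nu>" for \<nu>
  proof -
    note \<nu> = stieltjes_solutionD[OF that m]
    interpret \<nu>: real_distribution \<nu> by fact
    interpret pair_prob_space \<nu> ?B ..
    have exp_int: "integrable \<nu> (\<lambda>x. exp (r * \<bar>sqrt x\<bar>))"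
      by (rule stieltjes_exp_sqrt_integrable) fact+
    have w [measurable]: "w \<in> borel_measurable (\<nu> \<Otimes>\<^sub>M ?B)" unfolding w_def by measurable
    note pm = pair_integral_mult[OF \<nu>.sigma_finite_measure_axioms measure_pmf.sigma_finite_measure_axioms]
    have fin: "integrable ?B g" for g :: "bool \<Rightarrow> real"
      by (intro integrable_measure_pmf_finite) simp
    have 1: "real_distribution (S \<nu>)"
      unfolding S_def by (rule real_distribution_distr[OF w])
    have 2: "integrable (S \<nu>) (\<lambda>x. exp (r * \<bar>x\<bar>))"
      using pm(1)[OF exp_int fin[of "\<lambda>_. 1"]]
      by (simp add: S_def integrable_distr_eq w_def abs_mult if_distrib[of abs] cong: if_cong)
    have 3: "(\<integral>x. x ^ n \<partial>S \<nu>) = (if even n then m (n div 2) else 0)" for n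
    proof -
      have "integrable \<nu> (\<lambda>x. sqrt x ^ n)"
      proof (rule Bochner_Integration.integrable_bound[of _ "\<lambda>x. 1 + x ^ n"])
        show "AE x in \<nu>. norm (sqrt x ^ n) \<le> norm (1 + x ^ n)"
          using \<nu>(2)
        proof eventually_elim
          case (elim x)
          have "sqrt x ^ n \<le> 1 + x ^ n"
          proof (cases "x \<le> 1")
            case True
            then have "sqrt x ^ n \<le> 1" using elim by (intro power_le_one) auto
            then show ?thesis using elim by (simp add: add_increasing2)
          next
            case False
            then have "sqrt x \<le> x"
              using real_sqrt_le_iff[of x "x\<^sup>2"] power_increasing[of 1 2 x] by simp
            then have "sqrt x ^ n \<le> x ^ n" using elim by (intro power_mono) auto
            then show ?thesis by simp
          qed
          then show ?case using elim by simp
        qed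
      qed (use \<nu>(3) in auto)
      from pm(2)[OF this fin[of "\<lambda>b. (if b then 1 else - 1) ^ n"]]
      have "(\<integral>x. x ^ n \<partial>S \<nu>) = (\<integral>x. sqrt x ^ n \<partial>\<nu>) * (1 / 2 + (- 1) ^ n / 2)"
        by (simp add: S_def integral_distr w_def power_mult_distrib)
      moreover have "(\<integral>x. sqrt x ^ n \<partial>\<nu>) = m (n div 2)" if "even n"
      proof -
        have "AE x in \<nu>. sqrt x ^ n = x ^ (n div 2)"
          using \<nu>(2) by eventually_elim (use that in \<open>auto elim!: evenE simp: power_mult\<close>)
        then have "(\<integral>x. sqrt x ^ n \<partial>\<nu>) = (\<integral>x. x ^ (n div 2) \<partial>\<nu>)"
          by (intro integral_cong_AE) auto
        then show ?thesis by (simp add: \<nu>(4))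
      qed
      ultimately show ?thesis by auto
    qed
    have "AE b in ?B. True" by simp
    from AE_pair_fst_snd[OF measure_pmf.sigma_finite_measure_axioms \<nu>(2) this]
    have "AE p in \<nu> \<Otimes>\<^sub>M ?B. (w p)\<^sup>2 = fst p"
      by eventually_elim (simp add: w_def power_mult_distrib)
    then have "distr (\<nu> \<Otimes>\<^sub>M ?B) borel (\<lambda>p. (w p)\<^sup>2) = distr (\<nu> \<Otimes>\<^sub>M ?B) \<nu> fst"
      by (intro distr_cong_AE) auto
    also have "\<dots> = \<nu>" by (rule measure_pmf.distr_pair_fst)
    finally have 4: "distr (S \<nu>) borel (\<lambda>x. x\<^sup>2) = \<nu>"
      by (simp add: S_def distr_distr o_def)
    from 1 2 3 4 show ?thesis by blast
  qed
  have "S \<nu>1 = S \<nu>2"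
    by (rule real_distribution_determinate[of _ _ r]) (use S[OF sol(1)] S[OF sol(2)] r in auto)
  then show ?thesis using S[OF sol(1)] S[OF sol(2)] by metis
qed

section \<open>Perturbations that preserve all moments\<close>

text \<open>Stated for the sequence, so that neither solution has to be the law under study: of two
  different solutions, at least one differs from the law of any given variable with these
  moments.\<close>

definition stieltjes_non_unique :: "(nat \<Rightarrow> real) \<Rightarrow> bool" where
  "stieltjes_non_unique m \<longleftrightarrow>
     (\<exists>\<nu>1 \<nu>2. stieltjes_solution m \<nu>1 \<and> stieltjes_solution m \<nu>2 \<and> \<nu>1 \<noteq> \<nu>2)"

lemma not_moment_determinate:
  "stieltjes_non_unique (\<lambda>n. \<integral>\<omega>. X \<omega> ^ n \<partial>M) \<Longrightarrow> \<not> moment_determinate M X"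
  unfolding stieltjes_non_unique_def moment_determinate_def by metis

lemma powr_le_1_plus: "0 \<le> x \<Longrightarrow> 0 < q \<Longrightarrow> q \<le> 1 \<Longrightarrow> x powr q \<le> 1 + (x::real)"
  using powr_le1[of q x] powr_mono[of q 1 x] by (cases "x \<le> 1") auto

lemma integrable_powr:
  fixes q :: real
  assumes [measurable]: "X \<in> borel_measurable M" and "AE \<omega> in M. 0 \<le> X \<omega>"
    and "integrable M (\<lambda>\<omega>. 1 + X \<omega>)" "0 < q" "q \<le> 1"
  shows "integrable M (\<lambda>\<omega>. X \<omega> powr q)"
proof (rule Bochner_Integration.integrable_bound[OF assms(3)])
  show "AE \<omega> in M. norm (X \<omega> powr q) \<le> norm (1 + X \<omega>)"
    using assms(2) by eventually_elim (use powr_le_1_plus assms in auto)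
qed simp

text \<open>Both products have their \<open>q\<close>-th moment scaled by that of the common factor.
  This is nonzero because \<open>m' 1 \<noteq> 0\<close> prevents the factor from being almost
  surely 0, and finite because \<open>q \<le> 1\<close> lets the first moment control it.\<close>

lemma stieltjes_non_unique_mult:
  assumes sol: "stieltjes_solution m \<alpha>" "stieltjes_solution m \<beta>" and m: "m 0 = 1"
    and q: "0 < q" "q \<le> 1" and neq: "(\<integral>x. x powr q \<partial>\<alpha>) \<noteq> (\<integral>x. x powr q \<partial>\<beta>)"
    and m': "moment_seq m'" "m' 1 \<noteq> 0"
  shows "stieltjes_non_unique (\<lambda>n. m n * m' n)"
proof -
  obtain \<gamma> where "stieltjes_solution m' \<gamma>" and \<gamma>: "real_distribution \<gamma>" "AE x in \<gamma>. 0 \<le> x"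
    "\<And>n. integrable \<gamma> (\<lambda>x. x ^ n)" "\<And>n. (\<integral>x. x ^ n \<partial>\<gamma>) = m' n"
    using moment_seqE[OF m'(1)] by metis
  interpret \<gamma>: real_distribution \<gamma> by fact
  have powr_int: "integrable \<nu> (\<lambda>x. x powr q)"
    if "real_distribution \<nu>" "AE x in \<nu>. 0 \<le> x" "integrable \<nu> (\<lambda>x. x ^ 1)" for \<nu>
  proof -
    interpret real_distribution \<nu> by fact
    have "integrable \<nu> (\<lambda>x. 1 + x)" using that(3) by simp
    then show ?thesis by (intro integrable_powr[where X = "\<lambda>x. x"] that(2) q) simp_all
  qed
  have \<gamma>_int: "integrable \<gamma> (\<lambda>x. x powr q)" by (rule powr_int[OF \<gamma>(1,2,3)])
  have \<gamma>_neq: "(\<integral>x. x powr q \<partial>\<gamma>) \<noteq> 0"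
  proof
    assume "(\<integral>x. x powr q \<partial>\<gamma>) = 0"
    then have "AE x in \<gamma>. x powr q = 0"
      using integral_nonneg_eq_0_iff_AE[OF \<gamma>_int] by simp
    then have "AE x in \<gamma>. x = 0" by eventually_elim auto
    then have "(\<integral>x. x ^ 1 \<partial>\<gamma>) = 0" by (intro integral_eq_zero_AE) simp
    then show False using \<gamma>(4)[of 1] m'(2) by simp
  qed
  define P where "P = (\<lambda>\<nu>. distr (\<nu> \<Otimes>\<^sub>M \<gamma>) borel (\<lambda>p. fst p * snd p))"
  have P: "stieltjes_solution (\<lambda>n. m n * m' n) (P \<nu>)"
    "(\<integral>x. x powr q \<partial>P \<nu>) = (\<integral>x. x powr q \<partial>\<nu>) * (\<integral>x. x powr q \<partial>\<gamma>)"
    if "stieltjes_solution m \<nu>" for \<nu>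
  proof -
    note \<nu> = stieltjes_solutionD[OF that m]
    interpret \<nu>: real_distribution \<nu> by fact
    interpret pair_prob_space \<nu> \<gamma> ..
    note pm = pair_integral_mult[OF \<nu>.sigma_finite_measure_axioms \<gamma>.sigma_finite_measure_axioms]
    show "stieltjes_solution (\<lambda>n. m n * m' n) (P \<nu>)"
      unfolding P_def
      using that m \<open>stieltjes_solution m' \<gamma>\<close> m'(1) by (intro stieltjes_solution_mult) (auto simp: moment_seq_def)
    have "(\<integral>x. x powr q \<partial>P \<nu>) = (\<integral>p. (fst p * snd p) powr q \<partial>(\<nu> \<Otimes>\<^sub>M \<gamma>))"
      unfolding P_def by (rule integral_distr) auto
    also have "\<dots> = (\<integral>p. fst p powr q * snd p powr q \<partial>(\<nu> \<Otimes>\<^sub>M \<gamma>))"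
    proof (rule integral_cong_AE)
      show "AE p in \<nu> \<Otimes>\<^sub>M \<gamma>. (fst p * snd p) powr q = fst p powr q * snd p powr q"
        using AE_pair_fst_snd[OF \<gamma>.sigma_finite_measure_axioms \<nu>(2) \<gamma>(2)]
        by eventually_elim (simp add: powr_mult)
    qed auto
    also have "\<dots> = (\<integral>x. x powr q \<partial>\<nu>) * (\<integral>x. x powr q \<partial>\<gamma>)"
      by (rule pm(2)[OF powr_int[OF \<nu>(1,2,3)] \<gamma>_int])
    finally show "(\<integral>x. x powr q \<partial>P \<nu>) = (\<integral>x. x powr q \<partial>\<nu>) * (\<integral>x. x powr q \<partial>\<gamma>)" .
  qed
  have "P \<alpha> \<noteq> P \<beta>"
    using P(2)[OF sol(1)] P(2)[OF sol(2)] neq \<gamma>_neq by auto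
  then show ?thesis
    unfolding stieltjes_non_unique_def using P(1)[OF sol(1)] P(1)[OF sol(2)] by blast
qed

text \<open>A Stieltjes class: \<open>1 + s\<close> is a nonnegative density since \<open>s\<close>
  is bounded by 1, and it leaves the moments alone since \<open>s\<close> is orthogonal to all
  integer powers. The map \<open>\<phi>\<close> allows \<open>N\<close> to live in convenient
  coordinates, Gaussian or Gamma, instead of on the moment scale.\<close>

lemma stieltjes_non_unique_perturbation:
  fixes \<phi> s :: "'a \<Rightarrow> real"
  assumes [measurable]: "\<phi> \<in> borel_measurable N" "s \<in> borel_measurable N"
    and \<phi>: "\<And>x. 0 \<le> \<phi> x" and s: "\<And>x. \<bar>s x\<bar> \<le> 1"
    and int: "\<And>n. integrable N (\<lambda>x. \<phi> x ^ n)" "\<And>n. (\<integral>x. \<phi> x ^ n \<partial>N) = m n"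
    and zero: "\<And>n. (\<integral>x. s x * \<phi> x ^ n \<partial>N) = 0"
    and q: "0 < q" "q \<le> 1" and nonzero: "(\<integral>x. s x * \<phi> x powr q \<partial>N) \<noteq> 0"
    and m: "m 0 = 1" and m': "moment_seq m'" "m' 1 \<noteq> 0"
  shows "stieltjes_non_unique (\<lambda>n. m n * m' n)"
proof -
  have s1: "0 \<le> 1 + s x" for x using s[of x] by (simp add: abs_le_iff)
  have int_s: "integrable N (\<lambda>x. s x * f x)" if "integrable N f" for f :: "'a \<Rightarrow> real"
    using that s by (intro Bochner_Integration.integrable_bound[OF that])
      (auto intro!: AE_I2 mult_left_le_one_le simp: abs_mult)
  let ?D = "density N (\<lambda>x. ennreal (1 + s x))"
  have D: "integrable ?D f" "(\<integral>x. f x \<partial>?D) = (\<integral>x. f x \<partial>N) + (\<integral>x. s x * f x \<partial>N)"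
    if "integrable N f" for f :: "'a \<Rightarrow> real"
  proof -
    have [measurable]: "f \<in> borel_measurable N" using that by auto
    have *: "(1 + s x) * f x = f x + s x * f x" for x by (simp add: distrib_right)
    show "integrable ?D f"
      using int_s[OF that] that s1 by (subst integrable_density) (auto simp: *)
    show "(\<integral>x. f x \<partial>?D) = (\<integral>x. f x \<partial>N) + (\<integral>x. s x * f x \<partial>N)"
      using int_s[OF that] that s1 by (subst integral_density) (auto simp: *)
  qed
  have powr_int: "integrable N (\<lambda>x. \<phi> x powr q)"
    using int(1)[of 0] int(1)[of 1] q \<phi> by (intro integrable_powr) auto
  show ?thesis
  proof (rule stieltjes_non_unique_mult[where m = m and m' = m' and q = q
        and \<alpha> = "distr N borel \<phi>" and \<beta> = "distr ?D borel \<phi>"])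
    show "stieltjes_solution m (distr N borel \<phi>)"
      by (rule stieltjes_solution_distr) (use \<phi> int in auto)
    show "stieltjes_solution m (distr ?D borel \<phi>)"
      by (rule stieltjes_solution_distr) (use \<phi> int D[OF int(1)] zero in auto)
    show "(\<integral>x. x powr q \<partial>distr N borel \<phi>) \<noteq> (\<integral>x. x powr q \<partial>distr ?D borel \<phi>)"
      using D(2)[OF powr_int] nonzero by (subst (1 2) integral_distr) auto
  qed (use m m' q in auto)
qed

section \<open>Explicit perturbations of log-normal and Gamma power laws\<close>

lemma integral_sin_exp:
  fixes X :: "'a \<Rightarrow> real"
  assumes [measurable]: "X \<in> borel_measurable N" and int: "integrable N (\<lambda>x. exp (u * X x))"
  shows "(\<integral>x. sin (c * X x) * exp (u * X x) \<partial>N) =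
    Im (\<integral>x. exp (Complex u c * of_real (X x)) \<partial>N)"
proof -
  have "integrable N (\<lambda>x. exp (Complex u c * of_real (X x)))"
    by (rule Bochner_Integration.integrable_bound[OF int]) auto
  then have "Im (\<integral>x. exp (Complex u c * of_real (X x)) \<partial>N) =
      (\<integral>x. Im (exp (Complex u c * of_real (X x))) \<partial>N)" by simp
  also have "\<dots> = (\<integral>x. sin (c * X x) * exp (u * X x) \<partial>N)"
    by (simp add: Im_exp mult_ac)
  finally show ?thesis ..
qed

text \<open>For real arguments complete the square: tilting by \<open>exp (u * x)\<close> moves the
  mean to \<open>s\<^sup>2 * u\<close>. Complex arguments follow by analytic continuation.\<close>

lemma normal_exp_transform:
  fixes s :: real and z :: complex
  assumes "0 < s"
  defines "N \<equiv> density lborel (normal_density 0 s)"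
  shows "integrable N (\<lambda>x. exp (u * x))" "(\<integral>x. exp (u * x) \<partial>N) = exp (s\<^sup>2 * u\<^sup>2 / 2)"
    "(\<integral>x. exp (z * of_real x) \<partial>N) = exp (of_real (s\<^sup>2) * z\<^sup>2 / 2)"
proof -
  have eq: "normal_density 0 s x * exp (u * x) = exp (s\<^sup>2 * u\<^sup>2 / 2) * normal_density (s\<^sup>2 * u) s x" for u x
  proof -
    have "- x\<^sup>2 / (2 * s\<^sup>2) + u * x = s\<^sup>2 * u\<^sup>2 / 2 + - (x - s\<^sup>2 * u)\<^sup>2 / (2 * s\<^sup>2)"
      using \<open>0 < s\<close> by (simp add: field_simps power2_eq_square)
    then have "exp (- x\<^sup>2 / (2 * s\<^sup>2)) * exp (u * x) = exp (s\<^sup>2 * u\<^sup>2 / 2) * exp (- (x - s\<^sup>2 * u)\<^sup>2 / (2 * s\<^sup>2))"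
      by (simp only: exp_add[symmetric])
    then show ?thesis by (simp add: normal_density_def)
  qed
  have int: "integrable N (\<lambda>x. exp (u * x))" for u
    unfolding N_def using \<open>0 < s\<close>
    by (subst integrable_density) (auto simp: eq)
  have val: "(\<integral>x. exp (u * x) \<partial>N) = exp (s\<^sup>2 * u\<^sup>2 / 2)" for u
    unfolding N_def using \<open>0 < s\<close>
    by (subst integral_density) (auto simp: eq)
  show "integrable N (\<lambda>x. exp (u * x))" "(\<integral>x. exp (u * x) \<partial>N) = exp (s\<^sup>2 * u\<^sup>2 / 2)"
    by (fact int, fact val)
  show "(\<integral>x. exp (z * of_real x) \<partial>N) = exp (of_real (s\<^sup>2) * z\<^sup>2 / 2)"
  proof (rule exp_transform_eqI[where A = UNIV and a = 0 and b = 1])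
    show "(\<lambda>x. x) \<in> borel_measurable N" by (simp add: N_def)
  qed (auto simp: int val exp_of_real[symmetric] intro!: holomorphic_intros)
qed

text \<open>The classical perturbation of the log-normal law. The frequency
  \<open>c = 2 * pi / s\<^sup>2\<close> gives the transform at \<open>Complex u c\<close> the phase
  \<open>2 * pi * u\<close>, whose sine vanishes at every integer and equals 1 at
  \<open>u = 1/4\<close>, the order chosen for \<open>q\<close>.\<close>

lemma lognormal_non_unique:
  assumes "0 < s" and m': "moment_seq m'" "m' 1 \<noteq> 0"
  shows "stieltjes_non_unique (\<lambda>n. exp (s\<^sup>2 * (real n)\<^sup>2 / 2) * m' n)"
proof -
  define N where "N = density lborel (normal_density 0 s)"
  note T = normal_exp_transform[OF \<open>0 < s\<close>, folded N_def]
  define c where "c = 2 * pi / s\<^sup>2"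
  have sn [measurable_cong]: "sets N = sets borel" by (simp add: N_def)
  have sin: "(\<integral>x. sin (c * x) * exp (u * x) \<partial>N) = exp (s\<^sup>2 * (u\<^sup>2 - c\<^sup>2) / 2) * sin (2 * pi * u)" for u
  proof -
    have "Im (of_real (s\<^sup>2) * (Complex u c)\<^sup>2 / 2) = 2 * pi * u"
      using \<open>0 < s\<close> by (simp add: power2_eq_square c_def field_simps)
    moreover have "Re (of_real (s\<^sup>2) * (Complex u c)\<^sup>2 / 2) = s\<^sup>2 * (u\<^sup>2 - c\<^sup>2) / 2"
      by (simp add: power2_eq_square)
    ultimately show ?thesis
      by (subst integral_sin_exp) (simp_all only: T Im_exp, auto)
  qed
  show ?thesis
  proof (rule stieltjes_non_unique_perturbation[where N = N and \<phi> = exp and s = "\<lambda>x. sin (c * x)"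
        and q = "1/4", OF _ _ _ _ _ _ _ _ _ _ _ m'])
    show "integrable N (\<lambda>x. exp x ^ n)" "(\<integral>x. exp x ^ n \<partial>N) = exp (s\<^sup>2 * (real n)\<^sup>2 / 2)"
      "(\<integral>x. sin (c * x) * exp x ^ n \<partial>N) = 0" for n
      using T(1,2)[of "real n"] sin[of "real n"] sin_npi[of "2 * n"] by (simp_all add: exp_of_nat_mult[symmetric] mult_ac)
    show "(\<integral>x. sin (c * x) * exp x powr (1/4) \<partial>N) \<noteq> 0"
      using sin[of "1/4"] by (simp add: powr_def)
  qed auto
qed

text \<open>The Gamma density without its constant; unnormalized, it absorbs a power of
  \<open>x\<close> by a mere shift of the shape \<open>s\<close>.\<close>

definition gamma_kernel :: "real \<Rightarrow> real \<Rightarrow> real" where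
  "gamma_kernel s x = indicator {0<..} x * x powr (s - 1) * exp (- x)"

lemma gamma_kernel_measurable [measurable]: "gamma_kernel s \<in> borel_measurable borel"
  unfolding gamma_kernel_def by measurable

lemma gamma_kernel_nonneg: "0 \<le> gamma_kernel s x"
  by (simp add: gamma_kernel_def)

lemma gamma_kernel_exp_integral:
  assumes "0 < s" "u < 1"
  shows "has_bochner_integral lborel (\<lambda>x. gamma_kernel s x * exp (u * x)) (Gamma s * (1 - u) powr (- s))"
proof -
  have "has_bochner_integral lborel (gamma_kernel s) (Gamma s)"
  proof (rule has_bochner_integral_nn_integral)
    have "gamma_kernel s t = indicator {0..} t * t powr (s - 1) / exp t" for t
      by (auto simp: gamma_kernel_def indicator_def exp_minus divide_inverse)
    then show "(\<integral>\<^sup>+x. ennreal (gamma_kernel s x) \<partial>lborel) = ennreal (Gamma s)"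
      using Gamma_conv_nn_integral_real[OF \<open>0 < s\<close>] by simp
  qed (use assms in \<open>auto simp: gamma_kernel_nonneg Gamma_real_pos less_imp_le\<close>)
  then have "has_bochner_integral lborel (\<lambda>x. gamma_kernel s (0 + (1 - u) * x)) (Gamma s /\<^sub>R \<bar>1 - u\<bar>)"
    using assms by (subst lborel_has_bochner_integral_real_affine_iff[symmetric]) auto
  then have "has_bochner_integral lborel (\<lambda>x. (1 - u) powr (1 - s) * gamma_kernel s ((1 - u) * x))
      ((1 - u) powr (1 - s) * (Gamma s / (1 - u)))"
    using assms by (intro has_bochner_integral_mult_right) (simp add: divide_inverse mult.commute)
  moreover have "(1 - u) powr (1 - s) * gamma_kernel s ((1 - u) * x) = gamma_kernel s x * exp (u * x)" for x
  proof (cases "0 < x")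
    case True
    have "exp (- ((1 - u) * x)) = exp (- x) * exp (u * x)"
      by (simp add: exp_add[symmetric] algebra_simps)
    moreover have "(1 - u) powr (1 - s) * (1 - u) powr (s - 1) = 1"
      using assms by (simp add: powr_add[symmetric])
    ultimately show ?thesis
      using True assms by (simp add: gamma_kernel_def powr_mult)
  next
    case False
    then show ?thesis using assms by (simp add: gamma_kernel_def zero_less_mult_iff)
  qed
  moreover have "(1 - u) powr (1 - s) * (Gamma s / (1 - u)) = Gamma s * (1 - u) powr (- s)"
    using assms by (simp add: powr_diff powr_minus_divide)
  ultimately show ?thesis by simp
qed

text \<open>The transform \<open>Gamma s * (1 - z) powr (- s)\<close> continues from real
  \<open>z\<close> to the half-plane \<open>Re z < 1\<close>, where \<open>1 - z\<close> avoids the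
  branch cut, and is read off at the imaginary point \<open>z = \<i> * tan \<theta>\<close>.\<close>

lemma gamma_kernel_sin_integral:
  assumes "0 < s" "0 < \<theta>" "\<theta> < pi / 2"
  shows "(\<integral>x. gamma_kernel s x * sin (tan \<theta> * x) \<partial>lborel) = Gamma s * (cos \<theta> powr s * sin (s * \<theta>))"
proof -
  define N where "N = density lborel (gamma_kernel s)"
  have N: "integrable N (\<lambda>x. exp (u * x))" "(\<integral>x. exp (u * x) \<partial>N) = Gamma s * (1 - u) powr (- s)"
    if "u < 1" for u
    using gamma_kernel_exp_integral[OF \<open>0 < s\<close> that]
    by (auto simp: N_def integrable_density integral_density gamma_kernel_nonneg has_bochner_integral_iff)
  have cos: "0 < cos \<theta>" using assms by (intro cos_gt_zero) auto
  have "(\<integral>x. exp (Complex 0 (tan \<theta>) * of_real x) \<partial>N) =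
      of_real (Gamma s) * (1 - Complex 0 (tan \<theta>)) powr (- of_real s)"
  proof (rule exp_transform_eqI[where A = "{..<1}" and a = 0 and b = 1])
    show "(\<lambda>z. of_real (Gamma s) * (1 - z) powr (- of_real s)) holomorphic_on {z. Re z \<in> {..<1}}"
      by (intro holomorphic_intros) (auto simp: complex_nonpos_Reals_iff)
    show "complex_of_real (\<integral>x. exp (u * x) \<partial>N) = of_real (Gamma s) * (1 - of_real u) powr (- of_real s)"
      if "u < 1" for u
      using that powr_of_real[of "1 - u" "- s"] by (simp add: N)
  qed (auto simp: N, simp add: N_def)
  \<comment> \<open>Polar form: modulus \<open>1 / cos \<theta>\<close> and argument
    \<open>- \<theta>\<close>. The range of \<open>\<theta>\<close> makes this the principal
    argument, so the power multiplies it by \<open>- s\<close>.\<close>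
  also have "1 - Complex 0 (tan \<theta>) = exp (of_real (- ln (cos \<theta>)) - \<i> * of_real \<theta>)"
    using cos by (auto simp: complex_eq_iff Re_exp Im_exp exp_minus tan_def field_simps)
  also have "\<dots> powr (- of_real s) = exp (of_real (s * ln (cos \<theta>)) + \<i> * of_real (s * \<theta>))"
    using assms by (subst powr_def) (simp add: algebra_simps)
  finally have "Im (\<integral>x. exp (Complex 0 (tan \<theta>) * of_real x) \<partial>N) = Gamma s * (cos \<theta> powr s * sin (s * \<theta>))"
    using cos by (simp add: Im_exp powr_def)
  moreover have "Im (\<integral>x. exp (Complex 0 (tan \<theta>) * of_real x) \<partial>N) = (\<integral>x. sin (tan \<theta> * x) * exp (0 * x) \<partial>N)"
    using N(1)[of 0] by (intro integral_sin_exp[symmetric]) (auto simp: N_def)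
  moreover have "(\<integral>x. sin (tan \<theta> * x) * exp (0 * x) \<partial>N) = (\<integral>x. gamma_kernel s x * sin (tan \<theta> * x) \<partial>lborel)"
    unfolding N_def by (subst integral_density) (auto simp: gamma_kernel_nonneg)
  ultimately show ?thesis by simp
qed

text \<open>The law with density proportional to \<open>exp (- y powr (1 / t))\<close> on the positive half-line; for
  \<open>t > 2\<close> multiplication by \<open>1 + sin (tan (pi / t) * y powr (1 / t))\<close> does not change its moments.\<close>

lemma gamma_power_non_unique:
  assumes "2 < t" and m': "moment_seq m'" "m' 1 \<noteq> 0"
  shows "stieltjes_non_unique (\<lambda>n. Gamma (t * (real n + 1)) / Gamma t * m' n)"
proof -
  define N where "N = density lborel (\<lambda>x. gamma_kernel t x / Gamma t)"
  have G: "0 < Gamma t" using assms by (simp add: Gamma_real_pos)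
  \<comment> \<open>With this angle the sine integral for the shape \<open>t * (u + 1)\<close> has
    the phase \<open>pi * (u + 1)\<close>, which kills all integer orders; \<open>t > 2\<close> says
    exactly that the angle lies below \<open>pi / 2\<close>.\<close>
  define \<theta> where "\<theta> = pi / t"
  have \<theta>: "0 < \<theta>" "\<theta> < pi / 2"
    using assms by (simp_all add: \<theta>_def field_simps)
  have sn [measurable_cong]: "sets N = sets borel" by (simp add: N_def)
  have ker: "gamma_kernel t x * (x powr t) powr u = gamma_kernel (t * (u + 1)) x" for x u
    by (auto simp: gamma_kernel_def indicator_def powr_powr powr_add[symmetric] algebra_simps)
  have int: "integrable N (\<lambda>x. (x powr t) powr u)"
    "(\<integral>x. (x powr t) powr u \<partial>N) = Gamma (t * (u + 1)) / Gamma t"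
    "(\<integral>x. sin (tan \<theta> * x) * (x powr t) powr u \<partial>N) =
      Gamma (t * (u + 1)) / Gamma t * (cos \<theta> powr (t * (u + 1)) * sin (pi * (u + 1)))" if "0 \<le> u" for u
  proof -
    have pos: "0 < t * (u + 1)" using assms that by simp
    have ker_sin: "gamma_kernel t x * (sin (tan \<theta> * x) * (x powr t) powr u) =
        gamma_kernel (t * (u + 1)) x * sin (tan \<theta> * x)" for x
      by (simp add: ker[symmetric])
    note H = gamma_kernel_exp_integral[OF pos, of 0]
    show "integrable N (\<lambda>x. (x powr t) powr u)"
      "(\<integral>x. (x powr t) powr u \<partial>N) = Gamma (t * (u + 1)) / Gamma t"
      using H G unfolding N_def
      by (simp_all add: integrable_density integral_density ker gamma_kernel_nonneg has_bochner_integral_iff)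
    have \<theta>_eq: "t * (u + 1) * \<theta> = pi * (u + 1)" using assms by (simp add: \<theta>_def)
    show "(\<integral>x. sin (tan \<theta> * x) * (x powr t) powr u \<partial>N) =
      Gamma (t * (u + 1)) / Gamma t * (cos \<theta> powr (t * (u + 1)) * sin (pi * (u + 1)))"
      using gamma_kernel_sin_integral[OF pos \<theta>, unfolded \<theta>_eq] G unfolding N_def
      by (simp add: integral_density ker_sin gamma_kernel_nonneg)
  qed
  have AE_pos: "AE x in N. 0 < x"
    unfolding N_def by (subst AE_density) (auto simp: gamma_kernel_def indicator_def)
  \<comment> \<open>Only almost everywhere: at \<open>x = 0\<close> and \<open>n = 0\<close> the
    left side is 1, whereas \<open>0 powr 0 = 0\<close>.\<close>
  have power: "AE x in N. (x powr t) ^ n = (x powr t) powr real n" for n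
    using AE_pos by eventually_elim (simp add: powr_realpow)
  have cos: "0 < cos \<theta>" using \<theta> by (intro cos_gt_zero) auto
  show ?thesis
  proof (rule stieltjes_non_unique_perturbation[where N = N and \<phi> = "\<lambda>x. x powr t"
        and s = "\<lambda>x. sin (tan \<theta> * x)" and q = "1/2", OF _ _ _ _ _ _ _ _ _ _ _ m'])
    fix n
    show "integrable N (\<lambda>x. (x powr t) ^ n)"
      using power by (subst integrable_cong_AE[OF _ _ power]) (auto simp: int)
    show "(\<integral>x. (x powr t) ^ n \<partial>N) = Gamma (t * (real n + 1)) / Gamma t"
      by (subst integral_cong_AE[OF _ _ power]) (auto simp: int)
    have "(\<integral>x. sin (tan \<theta> * x) * (x powr t) ^ n \<partial>N) = (\<integral>x. sin (tan \<theta> * x) * (x powr t) powr real n \<partial>N)"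
      using power[of n] by (intro integral_cong_AE) auto
    moreover have "sin (pi * (real n + 1)) = 0"
      using sin_npi[of "Suc n"] by (simp add: mult.commute add.commute)
    ultimately show "(\<integral>x. sin (tan \<theta> * x) * (x powr t) ^ n \<partial>N) = 0"
      by (simp add: int)
  next
    have "sin (pi * (1/2 + 1)) = - 1"
      using sin_add[of "pi/2" pi] by (simp add: algebra_simps)
    moreover have "0 < Gamma (t * (1/2 + 1))" using assms by (intro Gamma_real_pos) simp
    ultimately show "(\<integral>x. sin (tan \<theta> * x) * (x powr t) powr (1/2) \<partial>N) \<noteq> 0"
      using G cos int(3)[of "1/2"] by simp
  qed (use G in auto)
qed

section \<open>Exponentials of Levy processes\<close>

definition levy_integrand :: "real \<Rightarrow> real \<Rightarrow> real" where
  "levy_integrand u r = exp (u * r) - 1 - u * (r * indicator {-1..1} r)"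

lemma levy_integrand_measurable [measurable]: "levy_integrand u \<in> borel_measurable borel"
  unfolding levy_integrand_def by measurable

text \<open>Valid without integrability: if the integral diverges, the complex and the real one both
  take the default value 0.\<close>

lemma levy_exponent_of_real:
  "levy_exponent b \<sigma> \<mu> (of_real u) =
    of_real (b * u + \<sigma>\<^sup>2 * u\<^sup>2 / 2 + (\<integral>r. levy_integrand u r \<partial>\<mu>))"
proof -
  have "(\<integral>r. (exp (of_real u * of_real r) - 1 - of_real u * complex_of_real (r * indicator {-1..1} r)) \<partial>\<mu>) =
      (\<integral>r. complex_of_real (levy_integrand u r) \<partial>\<mu>)"
    by (intro Bochner_Integration.integral_cong refl) (simp add: levy_integrand_def flip: exp_of_real)
  then show ?thesis by (simp add: levy_exponent_def)
qed

lemma levy_measure_finite_away_from_0: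
  assumes "levy_measure \<mu>" "0 < \<epsilon>" "\<epsilon> \<le> 1"
  shows "emeasure \<mu> {r. \<epsilon> < \<bar>r\<bar>} < \<infinity>"
proof -
  have [measurable_cong]: "sets \<mu> = sets borel" and fin: "(\<integral>\<^sup>+ r. ennreal (min 1 (r\<^sup>2)) \<partial>\<mu>) < \<infinity>"
    using assms(1) by (auto simp: levy_measure_def)
  have 1: "1 \<le> (1 / \<epsilon>\<^sup>2) * min 1 (r\<^sup>2)" if "\<epsilon> < \<bar>r\<bar>" for r
  proof -
    have "\<epsilon>\<^sup>2 \<le> r\<^sup>2" using that \<open>0 < \<epsilon>\<close> by (subst abs_le_square_iff[symmetric]) simp
    moreover have "\<epsilon>\<^sup>2 \<le> 1" using assms by (simp add: power_le_one)
    ultimately show ?thesis using \<open>0 < \<epsilon>\<close> by (simp add: min_def)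
  qed
  have "emeasure \<mu> {r. \<epsilon> < \<bar>r\<bar>} = (\<integral>\<^sup>+ r. indicator {r. \<epsilon> < \<bar>r\<bar>} r \<partial>\<mu>)" by simp
  also have "\<dots> \<le> (\<integral>\<^sup>+ r. ennreal (1 / \<epsilon>\<^sup>2) * ennreal (min 1 (r\<^sup>2)) \<partial>\<mu>)"
    using 1 by (intro nn_integral_mono)
      (auto simp: indicator_def ennreal_mult'[symmetric] simp del: times_divide_eq_left)
  also have "\<dots> = ennreal (1 / \<epsilon>\<^sup>2) * (\<integral>\<^sup>+ r. ennreal (min 1 (r\<^sup>2)) \<partial>\<mu>)"
    by (rule nn_integral_cmult) measurable
  also have "\<dots> < \<infinity>" using fin by (simp add: ennreal_mult_less_top)
  finally show ?thesis .
qed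

text \<open>Restricted to jumps larger than \<open>1 / (k + 1)\<close>, the measure is finite and
  the integral is a compound Poisson exponent plus a linear compensator. Dominated convergence then
  restores the small jumps.\<close>

lemma levy_khinchine_infdiv_exponent:
  assumes \<mu>: "levy_measure \<mu>" and int: "\<And>n::nat. integrable \<mu> (levy_integrand (real n))"
  shows "infdiv_exponent (\<lambda>n. \<integral>r. levy_integrand (real n) r \<partial>\<mu>)"
proof (rule infdiv_exponent_limit)
  define A where "A = (\<lambda>k::nat. {r::real. 1 / (real k + 1) < \<bar>r\<bar>})"
  have sets [measurable_cong]: "sets \<mu> = sets borel" using \<mu> by (simp add: levy_measure_def)
  have [measurable]: "A k \<in> sets borel" for k unfolding A_def by measurable
  show "infdiv_exponent (\<lambda>n. \<integral>r. indicator (A k) r * levy_integrand (real n) r \<partial>\<mu>)" for k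
  proof -
    define \<mu>' where "\<mu>' = density \<mu> (indicator (A k))"
    have [measurable_cong]: "sets \<mu>' = sets borel" by (simp add: \<mu>'_def sets)
    have "emeasure \<mu>' (space \<mu>') = emeasure \<mu> (A k)"
      by (simp add: \<mu>'_def emeasure_density sets_eq_imp_space_eq[OF sets])
    also have "\<dots> < \<infinity>"
      unfolding A_def by (rule levy_measure_finite_away_from_0[OF \<mu>]) (auto simp: divide_le_eq_1)
    finally interpret finite_measure \<mu>' by (intro finite_measureI) simp
    have dens: "\<mu>' = density \<mu> (\<lambda>r. ennreal (indicator (A k) r))"
      by (simp add: \<mu>'_def ennreal_indicator)
    have val: "(\<integral>r. f r \<partial>\<mu>') = (\<integral>r. indicator (A k) r * f r \<partial>\<mu>)"
      if [measurable]: "f \<in> borel_measurable borel" for f :: "real \<Rightarrow> real"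
      unfolding dens by (subst integral_density) auto
    have F: "integrable \<mu>' (levy_integrand (real n))" for n
      unfolding dens using integrable_mult_indicator[OF _ int[of n], of "A k"]
      by (subst integrable_density) auto
    have small: "integrable \<mu>' (\<lambda>r. r * indicator {-1..1} r)"
      by (rule integrable_const_bound[of _ 1]) (auto simp: indicator_def)
    have eq: "exp (real n * r) - 1 = levy_integrand (real n) r + real n * (r * indicator {-1..1} r)" for n r
      by (simp add: levy_integrand_def)
    have int1: "integrable \<mu>' (\<lambda>r. exp (real n * r) - 1)" for n
      unfolding eq by (intro Bochner_Integration.integrable_add F integrable_mult_right small)
    then have "integrable \<mu>' (\<lambda>r. (exp (real n * r) - 1) + 1)" for n
      by (intro Bochner_Integration.integrable_add) auto
    then have "infdiv_exponent (\<lambda>n. \<integral>r. exp (real n * r) - 1 \<partial>\<mu>')"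
      by (intro infdiv_exponent_compound_poisson finite_measure_axioms) (auto simp: \<mu>'_def sets)
    from infdiv_exponent_add[OF this infdiv_exponent_linear[of "- (\<integral>r. r * indicator {-1..1} r \<partial>\<mu>')"]]
    have "infdiv_exponent (\<lambda>n. (\<integral>r. exp (real n * r) - 1 \<partial>\<mu>') + - (\<integral>r. r * indicator {-1..1} r \<partial>\<mu>') * real n)" .
    also have "(\<lambda>n. (\<integral>r. exp (real n * r) - 1 \<partial>\<mu>') + - (\<integral>r. r * indicator {-1..1} r \<partial>\<mu>') * real n) =
        (\<lambda>n. \<integral>r. levy_integrand (real n) r \<partial>\<mu>')"
      unfolding eq using F small by (subst Bochner_Integration.integral_add) auto
    finally show ?thesis by (simp add: val)
  qed
  show "(\<lambda>k. \<integral>r. indicator (A k) r * levy_integrand (real n) r \<partial>\<mu>)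
      \<longlonglongrightarrow> (\<integral>r. levy_integrand (real n) r \<partial>\<mu>)" for n
  proof (rule integral_dominated_convergence[where w = "\<lambda>r. \<bar>levy_integrand (real n) r\<bar>"])
    show "AE r in \<mu>. (\<lambda>k. indicator (A k) r * levy_integrand (real n) r) \<longlonglongrightarrow> levy_integrand (real n) r"
    proof (rule AE_I2)
      fix r
      show "(\<lambda>k. indicator (A k) r * levy_integrand (real n) r) \<longlonglongrightarrow> levy_integrand (real n) r"
      proof (cases "r = 0")
        case True
        then show ?thesis by (simp add: levy_integrand_def)
      next
        case False
        have "(\<lambda>k. 1 / (real k + 1)) \<longlonglongrightarrow> 0" by real_asymp
        then have "\<forall>\<^sub>F k in sequentially. 1 / (real k + 1) < \<bar>r\<bar>"
          by (rule order_tendstoD) (use False in simp)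
        then have "\<forall>\<^sub>F k in sequentially.
            indicator (A k) r * levy_integrand (real n) r = levy_integrand (real n) r"
          by eventually_elim (simp add: A_def)
        then show ?thesis by (rule tendsto_eventually)
      qed
    qed
  qed (use int in \<open>auto simp: indicator_def\<close>)
qed

text \<open>For \<open>r \<ge> -1\<close> the integrand is nonnegative and nondecreasing in
  \<open>u \<ge> 0\<close>, by convexity of \<open>exp\<close> where the compensator acts. For
  \<open>r < -1\<close> it is bounded by 1, which is then the value of
  \<open>min 1 (r\<^sup>2)\<close>.\<close>

lemma levy_integrand_le:
  assumes "0 \<le> v" "v \<le> u"
  shows "\<bar>levy_integrand v r\<bar> \<le> \<bar>levy_integrand u r\<bar> + min 1 (r\<^sup>2)"
proof (cases "r < -1")
  case True
  then have "v * r \<le> 0" using assms by (simp add: mult_nonneg_nonpos)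
  then have "\<bar>exp (v * r) - 1\<bar> \<le> 1" by (simp add: abs_le_iff add_increasing2)
  moreover have "1 \<le> r\<^sup>2" using True power_mono[of 1 "- r" 2] by simp
  ultimately show ?thesis using True by (simp add: levy_integrand_def)
next
  case False
  have e: "w * r \<le> exp (w * r) - 1" for w
    using exp_ge_add_one_self[of "w * r"] by linarith
  have "0 \<le> levy_integrand v r \<and> levy_integrand v r \<le> levy_integrand u r"
  proof (cases "r \<le> 1")
    case True
    have "(u - v) * r \<le> exp (v * r) * ((u - v) * r)"
    proof (cases "0 \<le> r")
      case True
      then have "1 * ((u - v) * r) \<le> exp (v * r) * ((u - v) * r)"
        using assms by (intro mult_right_mono) auto
      then show ?thesis by simp
    next
      case False
      then have "v * r \<le> 0" "(u - v) * r \<le> 0"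
        using assms by (auto simp: mult_nonneg_nonpos)
      then have "1 * ((u - v) * r) \<le> exp (v * r) * ((u - v) * r)"
        by (intro mult_right_mono_neg) auto
      then show ?thesis by simp
    qed
    also have "\<dots> \<le> exp (v * r) * (exp ((u - v) * r) - 1)"
      by (intro mult_left_mono e) simp
    also have "\<dots> = exp (u * r) - exp (v * r)"
      by (simp add: right_diff_distrib exp_add[symmetric] left_diff_distrib)
    finally show ?thesis
      using e[of v] True \<open>\<not> r < -1\<close> by (simp add: levy_integrand_def left_diff_distrib)
  next
    case False
    then show ?thesis using assms by (simp add: levy_integrand_def mult_right_mono)
  qed
  then show ?thesis by (simp add: add_increasing2)
qed

lemma levy_integrand_integrable_mono:
  assumes \<mu>: "levy_measure \<mu>" and "0 \<le> v" "v \<le> u" and int: "integrable \<mu> (levy_integrand u)"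
  shows "integrable \<mu> (levy_integrand v)"
proof (rule Bochner_Integration.integrable_bound)
  have [measurable_cong]: "sets \<mu> = sets borel" using \<mu> by (simp add: levy_measure_def)
  show "levy_integrand v \<in> borel_measurable \<mu>" by measurable
  have "integrable \<mu> (\<lambda>r. min 1 (r\<^sup>2))"
    using \<mu> by (intro integrableI_nonneg) (auto simp: levy_measure_def)
  then show "integrable \<mu> (\<lambda>r. \<bar>levy_integrand u r\<bar> + min 1 (r\<^sup>2))"
    using int by (intro Bochner_Integration.integrable_add) auto
  show "AE r in \<mu>. norm (levy_integrand v r) \<le> norm (\<bar>levy_integrand u r\<bar> + min 1 (r\<^sup>2))"
    using levy_integrand_le[OF assms(2,3)] by (intro AE_I2) simp
qed

text \<open>If the integral in the exponent fails to converge at some \<open>v\<close>, its value is the junk \<open>0\<close> at all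
  \<open>u \<ge> v\<close>, and then by analyticity all moments are those of a log-normal variable.\<close>

lemma exp_moments_lognormal_factor:
  fixes X :: "'a \<Rightarrow> real"
  assumes "prob_space M" and X [measurable]: "X \<in> borel_measurable M" and \<mu>: "levy_measure \<mu>" and "0 \<le> t"
    and int: "\<And>u. 0 \<le> u \<Longrightarrow> integrable M (\<lambda>\<omega>. exp (u * X \<omega>))"
    and val: "\<And>u. 0 \<le> u \<Longrightarrow> (\<integral>\<omega>. exp (u * X \<omega>) \<partial>M) =
      exp (t * (b * u + \<sigma>\<^sup>2 * u\<^sup>2 / 2 + (\<integral>r. levy_integrand u r \<partial>\<mu>)))"
  obtains m where "moment_seq m" "m 1 \<noteq> 0"
    "\<And>n::nat. (\<integral>\<omega>. exp (real n * X \<omega>) \<partial>M) = exp (t * \<sigma>\<^sup>2 * (real n)\<^sup>2 / 2) * m n"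
proof (cases "\<forall>n::nat. integrable \<mu> (levy_integrand (real n))")
  case True
  then have "infdiv_exponent (\<lambda>n. t * (b * real n + (\<integral>r. levy_integrand (real n) r \<partial>\<mu>)))"
    using \<mu> \<open>0 \<le> t\<close>
    by (intro infdiv_exponent_scale infdiv_exponent_add infdiv_exponent_linear
        levy_khinchine_infdiv_exponent) auto
  then have seq: "moment_seq (\<lambda>n. exp (t * (b * real n + (\<integral>r. levy_integrand (real n) r \<partial>\<mu>))))"
    by (rule infdiv_exponentD)
  have eq: "(\<integral>\<omega>. exp (real n * X \<omega>) \<partial>M) = exp (t * \<sigma>\<^sup>2 * (real n)\<^sup>2 / 2) *
      exp (t * (b * real n + (\<integral>r. levy_integrand (real n) r \<partial>\<mu>)))" for n :: nat
    by (simp add: val exp_add[symmetric] algebra_simps)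
  show ?thesis by (rule that[OF seq _ eq]) simp
next
  case False
  then obtain v :: nat where v: "\<not> integrable \<mu> (levy_integrand (real v))" by blast
  define g where "g = (\<lambda>z::complex. exp (of_real t * (of_real b * z + of_real (\<sigma>\<^sup>2) * z\<^sup>2 / 2)))"
  \<comment> \<open>Beyond \<open>v\<close> the formula for the moments has lost its jump part;
    agreement on one unit interval there spreads to the whole open half-plane, in particular back to
    orders below \<open>v\<close>.\<close>
  have transform: "(\<integral>\<omega>. exp (z * of_real (X \<omega>)) \<partial>M) = g z" if "0 < Re z" for z
  proof (rule exp_transform_eqI[where A = "{0<..}" and a = "real v" and b = "real v + 1"])
    fix u assume u: "real v < u"
    then have "\<not> integrable \<mu> (levy_integrand u)"
      using levy_integrand_integrable_mono[OF \<mu>, of "real v" u] v by auto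
    then have "(\<integral>r. levy_integrand u r \<partial>\<mu>) = 0" by (rule not_integrable_integral_eq)
    then show "complex_of_real (\<integral>\<omega>. exp (u * X \<omega>) \<partial>M) = g (of_real u)"
      using u by (simp add: val g_def exp_of_real[symmetric])
  qed (use that int in \<open>auto simp: g_def intro!: holomorphic_intros\<close>)
  have "(\<integral>\<omega>. exp (real n * X \<omega>) \<partial>M) = exp (t * \<sigma>\<^sup>2 * (real n)\<^sup>2 / 2) * exp (t * b) ^ n" for n
  \<comment> \<open>Order 0 lies on the boundary of the half-plane, outside the reach of the
    continuation.\<close>
  proof (cases "n = 0")
    case True
    then show ?thesis using prob_space.prob_space[OF \<open>prob_space M\<close>] by simp
  next
    case False
    have "complex_of_real (\<integral>\<omega>. exp (real n * X \<omega>) \<partial>M) = (\<integral>\<omega>. exp (of_real (real n) * of_real (X \<omega>)) \<partial>M)"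
      by (simp flip: integral_complex_of_real exp_of_real)
    also have "\<dots> = g (of_real (real n))"
      using False by (intro transform) simp
    also have "\<dots> = complex_of_real (exp (t * (b * real n + \<sigma>\<^sup>2 * (real n)\<^sup>2 / 2)))"
      by (simp add: g_def exp_of_real[symmetric])
    finally have "(\<integral>\<omega>. exp (real n * X \<omega>) \<partial>M) = exp (t * (b * real n + \<sigma>\<^sup>2 * (real n)\<^sup>2 / 2))"
      by (simp only: of_real_eq_iff)
    then show ?thesis by (simp add: exp_of_nat_mult[symmetric] exp_add[symmetric] algebra_simps)
  qed
  then show ?thesis by (intro that[OF moment_seq_power[of "exp (t * b)"]]) auto
qed

section \<open>The moments \<open>(n + 1) powr (t * n)\<close>\<close>

text \<open>A single term of the series for \<open>exp (n + 1)\<close> bounds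
  \<open>(n + 1) ^ (2 * n) / fact (2 * n)\<close>. With \<open>r = 1/2\<close> the terms are
  therefore dominated by a geometric series of ratio \<open>exp 1 / 4 < 1\<close>.\<close>

lemma summable_power_moments:
  assumes "0 \<le> t" "t \<le> 2"
  shows "summable (\<lambda>n. (1/2) ^ (2 * n) / fact (2 * n) * exp (t * (real n * ln (real n + 1))))"
proof (rule summable_comparison_test')
  show "summable (\<lambda>n. exp 1 * (exp 1 / 4) ^ n :: real)"
    using exp_le by (intro summable_mult summable_geometric) simp
  fix n :: nat
  have "exp (t * (real n * ln (real n + 1))) \<le> exp (2 * (real n * ln (real n + 1)))"
    using assms by (simp add: mult_right_mono)
  also have "\<dots> = (real n + 1) ^ (2 * n)"
    by (simp add: powr_realpow[symmetric] powr_def)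
  finally have 1: "exp (t * (real n * ln (real n + 1))) \<le> (real n + 1) ^ (2 * n)" .
  have "(real n + 1) ^ (2 * n) / fact (2 * n) \<le> exp (real n + 1)"
    using sum_le_suminf[OF sums_summable[OF exp_converges[of "real n + 1"]], of "{2 * n}"]
      sums_unique[OF exp_converges[of "real n + 1"]]
    by (simp add: divide_inverse mult.commute)
  with 1 have "exp (t * (real n * ln (real n + 1))) / fact (2 * n) \<le> exp (real n + 1)"
    by (meson divide_right_mono fact_ge_zero order_trans)
  then have "(1/4) ^ n * (exp (t * (real n * ln (real n + 1))) / fact (2 * n)) \<le> (1/4) ^ n * exp (real n + 1)"
    by (intro mult_left_mono) auto
  also have "\<dots> = exp 1 * (exp 1 / 4) ^ n"
    by (simp add: exp_add power_divide exp_of_nat_mult[symmetric])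
  finally show "norm ((1/2) ^ (2 * n) / fact (2 * n) * exp (t * (real n * ln (real n + 1)))) \<le>
      exp 1 * (exp 1 / 4) ^ n"
    by (simp add: power_mult power_divide)
qed

lemma power_moments_non_unique:
  assumes "2 < t"
  shows "stieltjes_non_unique (\<lambda>n. exp (t * (real n * ln (real n + 1))))"
proof -
  define g where "g = (\<lambda>n::nat. t * real n * ln (real n + 1) - (ln_Gamma (t * (real n + 1)) - ln_Gamma t))"
  have "moment_seq (\<lambda>n. exp (g n))"
    unfolding g_def
    by (rule infdiv_exponentD[OF infdiv_exponent_power_over_Gamma]) (use assms in simp)
  then have "stieltjes_non_unique (\<lambda>n. Gamma (t * (real n + 1)) / Gamma t * exp (g n))"
    by (rule gamma_power_non_unique[OF assms]) simp
  moreover have "Gamma (t * (real n + 1)) / Gamma t * exp (g n) = exp (t * (real n * ln (real n + 1)))" for n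
  proof -
    have "Gamma (t * (real n + 1)) = exp (ln_Gamma (t * (real n + 1)))" "Gamma t = exp (ln_Gamma t)"
      using assms by (auto intro!: Gamma_real_pos_exp)
    then show ?thesis by (simp add: g_def exp_add[symmetric] exp_diff[symmetric] mult.assoc)
  qed
  ultimately show ?thesis by simp
qed

theorem theorem2p1:
  fixes M :: "'a measure" and Y :: "real \<Rightarrow> 'a \<Rightarrow> real"
    and b \<sigma> :: real and \<mu> :: "real measure" and \<Psi> :: "complex \<Rightarrow> complex"
  assumes "levy_process M Y"
    and "\<And>u t. 0 \<le> u \<Longrightarrow> 0 \<le> t \<Longrightarrow> integrable M (\<lambda>\<omega>. exp (u * Y t \<omega>))"
    and "0 \<le> \<sigma>" and "levy_measure \<mu>"
    and "\<Psi> = levy_exponent b \<sigma> \<mu>"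
    and "has_characteristic_exponent M Y \<Psi>"
    and "\<And>u t. 0 \<le> u \<Longrightarrow> 0 \<le> t \<Longrightarrow>
           complex_of_real (\<integral>\<omega>. exp (u * Y t \<omega>) \<partial>M) = exp (of_real t * \<Psi> (of_real u))"
  shows "(\<sigma>\<^sup>2 > 0 \<longrightarrow> (\<forall>t>0. moment_indeterminate M (\<lambda>\<omega>. exp (Y t \<omega>)))) \<and>
         ((\<forall>u\<ge>0. \<Psi> (complex_of_real u) = complex_of_real (u * ln (u + 1))) \<longrightarrow>
            (\<forall>t\<ge>0. moment_determinate M (\<lambda>\<omega>. exp (Y t \<omega>)) \<longleftrightarrow> t \<le> 2))"
proof -
  interpret levy_process M Y by fact
  have power: "exp (Y t \<omega>) ^ n = exp (real n * Y t \<omega>)" for t \<omega> n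
    by (simp add: exp_of_nat_mult)
  have nonneg: "nonneg_with_moments M (\<lambda>\<omega>. exp (Y t \<omega>))" if "0 \<le> t" for t
    using assms(2)[OF _ that] random_variable[OF that]
    by (simp add: nonneg_with_moments_def power)
  have "moment_indeterminate M (\<lambda>\<omega>. exp (Y t \<omega>))" if \<sigma>: "0 < \<sigma>\<^sup>2" and t: "0 < t" for t
  proof -
    have val: "(\<integral>\<omega>. exp (u * Y t \<omega>) \<partial>M) =
        exp (t * (b * u + \<sigma>\<^sup>2 * u\<^sup>2 / 2 + (\<integral>r. levy_integrand u r \<partial>\<mu>)))" if "0 \<le> u" for u
    proof -
      have "complex_of_real (\<integral>\<omega>. exp (u * Y t \<omega>) \<partial>M) =
          of_real (exp (t * (b * u + \<sigma>\<^sup>2 * u\<^sup>2 / 2 + (\<integral>r. levy_integrand u r \<partial>\<mu>))))"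
        using assms(7)[OF that, of t] t
        by (simp only: assms(5) levy_exponent_of_real of_real_mult[symmetric] exp_of_real less_imp_le)
      then show ?thesis by (simp only: of_real_eq_iff)
    qed
    have t': "0 \<le> t" using t by simp
    obtain m where m: "moment_seq m" "m 1 \<noteq> 0"
      "\<And>n::nat. (\<integral>\<omega>. exp (real n * Y t \<omega>) \<partial>M) = exp (t * \<sigma>\<^sup>2 * (real n)\<^sup>2 / 2) * m n"
      using exp_moments_lognormal_factor[OF prob_space_axioms random_variable[OF t'] assms(4) t'
          assms(2)[OF _ t'] val] by metis
    \<comment> \<open>The parameter is the standard deviation at time \<open>t\<close> of the
      Gaussian component, positive because \<open>t\<close> and \<open>\<sigma>\<^sup>2\<close>
      are.\<close>
    have "stieltjes_non_unique (\<lambda>n. exp ((sqrt (t * \<sigma>\<^sup>2))\<^sup>2 * (real n)\<^sup>2 / 2) * m n)"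
      using m(1,2) \<sigma> t by (intro lognormal_non_unique) auto
    then have "stieltjes_non_unique (\<lambda>n. \<integral>\<omega>. exp (Y t \<omega>) ^ n \<partial>M)"
      using t by (simp add: power m(3))
    from not_moment_determinate[OF this] show ?thesis
      using nonneg[OF t'] by (simp add: moment_indeterminate_def)
  qed
  moreover have "moment_determinate M (\<lambda>\<omega>. exp (Y t \<omega>)) \<longleftrightarrow> t \<le> 2"
    if \<Psi>: "\<forall>u\<ge>0. \<Psi> (complex_of_real u) = complex_of_real (u * ln (u + 1))" and t: "0 \<le> t" for t
  proof -
    have moments: "(\<integral>\<omega>. exp (Y t \<omega>) ^ n \<partial>M) = exp (t * (real n * ln (real n + 1)))" for n
    proof -
      have "complex_of_real (\<integral>\<omega>. exp (real n * Y t \<omega>) \<partial>M) = of_real (exp (t * (real n * ln (real n + 1))))"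
        using assms(7)[of "real n" t] \<Psi> t
        by (simp only: of_nat_0_le_iff of_real_mult[symmetric] exp_of_real)
      then show ?thesis by (simp only: power of_real_eq_iff)
    qed
    show ?thesis
    proof (cases "t \<le> 2")
      case True
      have "stieltjes_solution (\<lambda>n. \<integral>\<omega>. exp (Y t \<omega>) ^ n \<partial>M) (distr M borel (\<lambda>\<omega>. exp (Y t \<omega>)))"
        using nonneg[OF t] by (intro stieltjes_solution_distr) (auto simp: nonneg_with_moments_def)
      then have "moment_determinate M (\<lambda>\<omega>. exp (Y t \<omega>))"
        unfolding moment_determinate_def moments
        using nonneg[OF t] stieltjes_determinate[OF _ _ _ _ summable_power_moments[OF t True]] by auto
      with True show ?thesis by simp
    next
      case False
      then have "stieltjes_non_unique (\<lambda>n. \<integral>\<omega>. exp (Y t \<omega>) ^ n \<partial>M)"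
        unfolding moments by (intro power_moments_non_unique) simp
      from not_moment_determinate[OF this] False show ?thesis by simp
    qed
  qed
  ultimately show ?thesis by blast
qed

end
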